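(* Let $\mathfrak M$ be a Hilbert space and $\mathcal E:=\mathbb C\setminus\{(-\infty,-1]\cup[1,+\infty)\}$. 1) If the function $\Omega$ from $\mathcal{RS}(\mathfrak M)$ is inner, then the equality $$\Omega(z)=\left(\Omega\left(\frac{z+a}{1+az}\right)-aI_{\mathfrak M}\right)\left(I_{\mathfrak M}-a\,\Omega\left(\frac{z+a}{1+az}\right)\right)^{-1}\qquad( * )$$ holds for all $a\in(-1,1)$ and all $z\in\mathcal E$. 2) If $\Omega\in\mathcal{RS}(\mathfrak M)$ and $( * )$ holds (for all $z\in\mathcal E$) for some $a\in(-1,1)$, $a\ne0$, then $\Omega$ is an inner function.
   Context: Hilbert spaces are complex and separable. A $\mathbf B(\mathfrak M)$-valued function $M$ is a Nevanlinna function if it is holomorphic outside the real axis, $M(\lambda)^*=M(\bar\lambda)$, and $\operatorname{Im}\lambda\,\operatorname{Im}M(\lambda)\ge0$ for all $\lambda\in\mathbb C\setminus\mathbb R$. The class $\mathcal{RS}(\mathfrak M)$ consists of all $\mathbf B(\mathfrak M)$-valued Nevanlinna functions $\Omega$ which are holomorphic on $\mathcal E$ and satisfy $-I\le\Omega(x)\le I$ for all $x\in(-1,1)$; such functions are contractive on the unit disk. $\Omega\in\mathcal{RS}(\mathfrak M)$ is inner if $\Omega(\xi)$ is isometric for almost every $\xi$ in the unit circle $\mathbb T$ (note $\mathbb T\setminus\{\pm1\}\subset\mathcal E$). *)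

theory Defs
  imports "HOL-Analysis.Analysis"
begin

section \<open>Complex Hilbert spaces\<close>

text \<open>The scalar product is linear in its first argument; its real part is the
  \<^class>\<open>real_inner\<close> product, so positivity, definiteness and the relation with the norm
  are inherited from \<^class>\<open>real_inner\<close>, and completeness from \<^class>\<open>banach\<close>.\<close>

class complex_hilbert_space = real_inner + banach +
  fixes scaleC :: "complex \<Rightarrow> 'a \<Rightarrow> 'a" (infixr "*\<^sub>C" 75)
    and cinner :: "'a \<Rightarrow> 'a \<Rightarrow> complex"
  assumes scaleC_add_right: "c *\<^sub>C (x + y) = c *\<^sub>C x + c *\<^sub>C y"
    and scaleC_add_left: "(c + d) *\<^sub>C x = c *\<^sub>C x + d *\<^sub>C x"
    and scaleC_scaleC: "c *\<^sub>C (d *\<^sub>C x) = (c * d) *\<^sub>C x"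
    and scaleC_of_real: "complex_of_real r *\<^sub>C x = r *\<^sub>R x"
    and cinner_commute: "cinner x y = cnj (cinner y x)"
    and cinner_add_left: "cinner (x + y) z = cinner x z + cinner y z"
    and cinner_scaleC_left: "cinner (c *\<^sub>C x) y = c * cinner x y"
    and Re_cinner: "Re (cinner x y) = inner x y"

instantiation complex :: complex_hilbert_space
begin

definition scaleC_complex :: "complex \<Rightarrow> complex \<Rightarrow> complex" where
  "scaleC_complex c x = c * x"

definition cinner_complex :: "complex \<Rightarrow> complex \<Rightarrow> complex" where
  "cinner_complex x y = x * cnj y"

instance
  by standard
    (auto simp: scaleC_complex_def cinner_complex_def algebra_simps scaleR_conv_of_real inner_complex_def)

end

lemma cinner_scaleC_right: "cinner x (c *\<^sub>C y) = cnj c * cinner x y"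
  by (metis cinner_commute cinner_scaleC_left complex_cnj_mult)

lemma cinner_self: "cinner x x = complex_of_real ((norm x)\<^sup>2)"
proof (rule complex_eqI)
  show "Re (cinner x x) = Re (complex_of_real ((norm x)\<^sup>2))"
    by (simp add: Re_cinner power2_norm_eq_inner)
  have "Im (cinner x x) = - Im (cinner x x)"
    using arg_cong[OF cinner_commute[of x x], of Im] by simp
  then show "Im (cinner x x) = Im (complex_of_real ((norm x)\<^sup>2))"
    by simp
qed

lemma norm_scaleC: "norm (c *\<^sub>C x) = cmod c * norm x"
proof -
  have "cinner (c *\<^sub>C x) (c *\<^sub>C x) = (c * cnj c) * cinner x x"
    by (simp add: cinner_scaleC_left cinner_scaleC_right)
  also have "\<dots> = complex_of_real ((cmod c * norm x)\<^sup>2)"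
    unfolding cinner_self complex_norm_square[symmetric]
    by (simp add: power_mult_distrib)
  finally have "cinner (c *\<^sub>C x) (c *\<^sub>C x) = complex_of_real ((cmod c * norm x)\<^sup>2)" .
  then have "(norm (c *\<^sub>C x))\<^sup>2 = (cmod c * norm x)\<^sup>2"
    unfolding cinner_self of_real_eq_iff .
  then show ?thesis
    by (simp add: power2_eq_iff_nonneg)
qed

lemma bounded_linear_scaleC: "bounded_linear (\<lambda>x. c *\<^sub>C x)"
proof (rule bounded_linear_intro)
  show "c *\<^sub>C (r *\<^sub>R x) = r *\<^sub>R (c *\<^sub>C x)" for r x
    by (metis scaleC_of_real scaleC_scaleC mult.commute)
  show "norm (c *\<^sub>C x) \<le> norm x * cmod c" for x
    by (simp add: norm_scaleC mult.commute)
qed (rule scaleC_add_right)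


section \<open>Bounded operators\<close>

text \<open>\<^typ>\<open>'a \<Rightarrow>\<^sub>L 'a\<close> contains all bounded real-linear operators; the algebra of
  bounded complex-linear operators is the following subset.\<close>

definition bounded_ops :: "('a::complex_hilbert_space \<Rightarrow>\<^sub>L 'a) set" where
  "bounded_ops = {T. \<forall>c x. blinfun_apply T (c *\<^sub>C x) = c *\<^sub>C blinfun_apply T x}"

lift_definition scaleC_op ::
  "complex \<Rightarrow> ('a::complex_hilbert_space \<Rightarrow>\<^sub>L 'a) \<Rightarrow> ('a \<Rightarrow>\<^sub>L 'a)"
  is "\<lambda>c T x. c *\<^sub>C T x"
  by (rule bounded_linear_compose[OF bounded_linear_scaleC])

definition adj_op :: "('a::complex_hilbert_space \<Rightarrow>\<^sub>L 'a) \<Rightarrow> ('a \<Rightarrow>\<^sub>L 'a)" where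
  "adj_op T = (THE S. \<forall>x y. cinner (blinfun_apply T x) y = cinner x (blinfun_apply S y))"

lemma riesz_real:
  fixes f :: "'a::{real_inner, banach} \<Rightarrow> real"
  assumes "bounded_linear f"
  shows "\<exists>u. \<forall>x. f x = inner x u"
proof -
  interpret f: bounded_linear f by fact
  obtain K where K: "\<And>x. norm (f x) \<le> norm x * K"
    using f.bounded by blast
  define J where "J x = inner x x - 2 * f x" for x
  have lower: "- K\<^sup>2 \<le> J x" for x
  proof -
    have "f x \<le> norm x * K" using K[of x] by simp
    moreover have "0 \<le> (norm x - K)\<^sup>2" by simp
    ultimately show ?thesis
      by (simp add: J_def power2_diff flip: power2_norm_eq_inner)
  qed
  then have bdd: "bdd_below (range J)"
    by (intro bdd_belowI[of _ "- K\<^sup>2"]) auto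
  define m where "m = (INF x. J x)"
  have m: "m \<le> J x" for x
    unfolding m_def using bdd by (rule cINF_lower) simp
  have par: "(norm (x - y))\<^sup>2 = 2 * J x + 2 * J y - 4 * J ((1/2) *\<^sub>R (x + y))" for x y
    by (simp add: J_def power2_norm_eq_inner inner_diff_left inner_diff_right inner_add_left
        inner_add_right f.add f.scaleR inner_commute[of y x] algebra_simps)
  have close: "(norm (x - y))\<^sup>2 \<le> 4 * e" if "J x < m + e" "J y < m + e" for x y e
    using that m[of "(1/2) *\<^sub>R (x + y)"] unfolding par by linarith
  have "\<exists>x. J x < m + inverse (real (Suc n))" for n
    using cINF_less_iff[OF _ bdd, of "m + inverse (real (Suc n))"]
    unfolding m_def by (force simp del: of_nat_Suc)
  then obtain X where X: "\<And>n. J (X n) < m + inverse (real (Suc n))"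
    by metis
  have "Cauchy X"
  proof (rule CauchyI)
    fix e :: real assume "0 < e"
    then have "0 < e\<^sup>2 / 4" by simp
    then obtain N where N: "inverse (real (Suc N)) < e\<^sup>2 / 4"
      using reals_Archimedean by blast
    have XN: "J (X n) < m + inverse (real (Suc N))" if "N \<le> n" for n
    proof -
      have "inverse (real (Suc n)) \<le> inverse (real (Suc N))"
        using that by (simp add: field_simps)
      with X[of n] show ?thesis by linarith
    qed
    have "norm (X i - X j) < e" if "N \<le> i" "N \<le> j" for i j
    proof -
      have "(norm (X i - X j))\<^sup>2 < e\<^sup>2"
        using close[OF XN XN, OF that] N by linarith
      with \<open>0 < e\<close> show ?thesis by (simp add: power2_less_imp_less)
    qed
    then show "\<exists>M. \<forall>i\<ge>M. \<forall>j\<ge>M. norm (X i - X j) < e" by blast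
  qed
  then obtain u where u: "X \<longlonglongrightarrow> u"
    using Cauchy_convergent convergent_def by blast
  have "(\<lambda>n. J (X n)) \<longlonglongrightarrow> J u"
    unfolding J_def by (intro tendsto_intros f.tendsto u)
  moreover have "(\<lambda>n. m + inverse (real (Suc n))) \<longlonglongrightarrow> m + 0"
    by (intro tendsto_intros LIMSEQ_inverse_real_of_nat)
  ultimately have "J u \<le> m"
    using LIMSEQ_le[of "\<lambda>n. J (X n)" "J u" "\<lambda>n. m + inverse (real (Suc n))" m] X
    by (auto intro: less_imp_le)
  with m have min: "J u \<le> J x" for x
    by (meson order_trans)
  have "f y = inner y u" for y
  proof (rule ccontr)
    define d where "d = inner y u - f y"
    assume "f y \<noteq> inner y u"
    then have d: "d \<noteq> 0" by (simp add: d_def)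
    then have "y \<noteq> 0" by (auto simp: d_def f.zero)
    then have ny: "inner y y > 0" by simp
    have "J (u + t *\<^sub>R y) = J u + 2 * t * d + t\<^sup>2 * inner y y" for t
      by (simp add: J_def d_def inner_add_left inner_add_right f.add f.scaleR
          inner_commute[of u y] power2_eq_square algebra_simps)
    then have "0 \<le> 2 * t * d + t\<^sup>2 * inner y y" for t
      using min[of "u + t *\<^sub>R y"] by simp
    from this[of "- d / inner y y"] ny have "0 \<le> - (d\<^sup>2 / inner y y)"
      by (simp add: power2_eq_square field_simps)
    moreover have "d\<^sup>2 / inner y y > 0"
      using d ny by simp
    ultimately show False by linarith
  qed
  then show ?thesis by blast
qed

lemma cinner_adj_op:
  fixes T :: "'a::complex_hilbert_space \<Rightarrow>\<^sub>L 'a"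
  assumes "T \<in> bounded_ops"
  shows "cinner (blinfun_apply T x) y = cinner x (blinfun_apply (adj_op T) y)"
proof -
  have "\<exists>u. \<forall>x. inner (blinfun_apply T x) y = inner x u" for y
    by (rule riesz_real) (intro bounded_linear_intros)
  then obtain S where S: "\<And>x y. inner (blinfun_apply T x) y = inner x (S y)"
    by metis
  have ext: "a = b" if "\<And>x. inner x a = inner x b" for a b :: 'a
    by (metis that vector_eq_ldot)
  have "bounded_linear S"
  proof (rule bounded_linear_intro)
    show "S (a + b) = S a + S b" for a b
      by (rule ext) (simp add: inner_add_right flip: S)
    show "S (r *\<^sub>R a) = r *\<^sub>R S a" for r a
      by (rule ext) (simp flip: S)
    show "norm (S a) \<le> norm a * norm T" for a
    proof (cases "S a = 0")
      case False
      have "norm (S a) * norm (S a) = inner (blinfun_apply T (S a)) a"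
        by (simp add: S norm_eq_sqrt_inner)
      also have "\<dots> \<le> norm (blinfun_apply T (S a)) * norm a"
        by (rule norm_cauchy_schwarz)
      also have "\<dots> \<le> norm T * norm (S a) * norm a"
        by (intro mult_right_mono norm_blinfun) simp
      finally have "norm (S a) * norm (S a) \<le> norm (S a) * (norm a * norm T)"
        by (simp add: mult_ac)
      with False show ?thesis by (simp add: mult_le_cancel_left)
    qed simp
  qed
  then have app: "blinfun_apply (Blinfun S) = S"
    by (rule bounded_linear_Blinfun_apply)
  have Im: "Im (cinner a b) = inner ((- \<i>) *\<^sub>C a) b" for a b :: 'a
    by (simp add: cinner_scaleC_left flip: Re_cinner)
  have ex: "\<forall>x y. cinner (blinfun_apply T x) y = cinner x (blinfun_apply (Blinfun S) y)"
  proof (intro allI complex_eqI)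
    fix x y
    show "Re (cinner (blinfun_apply T x) y) = Re (cinner x (blinfun_apply (Blinfun S) y))"
      by (simp add: app Re_cinner S)
    have "(- \<i>) *\<^sub>C blinfun_apply T x = blinfun_apply T ((- \<i>) *\<^sub>C x)"
      using assms by (simp add: bounded_ops_def)
    then show "Im (cinner (blinfun_apply T x) y) = Im (cinner x (blinfun_apply (Blinfun S) y))"
      unfolding app Im by (simp add: S)
  qed
  have uniq: "R = Blinfun S"
    if "\<forall>x y. cinner (blinfun_apply T x) y = cinner x (blinfun_apply R y)" for R
  proof (rule blinfun_eqI)
    show "blinfun_apply R y = blinfun_apply (Blinfun S) y" for y
      by (rule ext) (metis Re_cinner ex that)
  qed
  show ?thesis
    using theI[of "\<lambda>S. \<forall>x y. cinner (blinfun_apply T x) y = cinner x (blinfun_apply S y)",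
        OF ex uniq]
    unfolding adj_op_def by blast
qed

definition im_op :: "('a::complex_hilbert_space \<Rightarrow>\<^sub>L 'a) \<Rightarrow> ('a \<Rightarrow>\<^sub>L 'a)" where
  "im_op T = scaleC_op (1 / (2 * \<i>)) (T - adj_op T)"

definition op_nonneg :: "('a::complex_hilbert_space \<Rightarrow>\<^sub>L 'a) \<Rightarrow> bool" where
  "op_nonneg T \<longleftrightarrow>
    (\<forall>x. cinner (blinfun_apply T x) x \<in> \<real> \<and> 0 \<le> Re (cinner (blinfun_apply T x) x))"

definition op_le :: "('a::complex_hilbert_space \<Rightarrow>\<^sub>L 'a) \<Rightarrow> ('a \<Rightarrow>\<^sub>L 'a) \<Rightarrow> bool" where
  "op_le S T \<longleftrightarrow> op_nonneg (T - S)"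

definition op_isometric :: "('a::complex_hilbert_space \<Rightarrow>\<^sub>L 'a) \<Rightarrow> bool" where
  "op_isometric T \<longleftrightarrow> (\<forall>x. norm (blinfun_apply T x) = norm x)"

definition op_invertible :: "('a::complex_hilbert_space \<Rightarrow>\<^sub>L 'a) \<Rightarrow> bool" where
  "op_invertible T \<longleftrightarrow> (\<exists>S. S o\<^sub>L T = id_blinfun \<and> T o\<^sub>L S = id_blinfun)"

text \<open>Only meaningful for \<^const>\<open>op_invertible\<close> operators.\<close>

definition op_inverse :: "('a::complex_hilbert_space \<Rightarrow>\<^sub>L 'a) \<Rightarrow> ('a \<Rightarrow>\<^sub>L 'a)" where
  "op_inverse T = (THE S. S o\<^sub>L T = id_blinfun \<and> T o\<^sub>L S = id_blinfun)"


section \<open>Operator-valued functions\<close>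

text \<open>Holomorphy of a function with values in the bounded complex-linear operators, with
  respect to the operator norm: the real derivative at each point is multiplication of a
  fixed operator by the complex increment.\<close>

definition op_holomorphic_on ::
  "(complex \<Rightarrow> 'a::complex_hilbert_space \<Rightarrow>\<^sub>L 'a) \<Rightarrow> complex set \<Rightarrow> bool" where
  "op_holomorphic_on M S \<longleftrightarrow>
    (\<forall>z\<in>S. M z \<in> bounded_ops) \<and>
    (\<forall>z\<in>S. \<exists>D\<in>bounded_ops. (M has_derivative (\<lambda>h. scaleC_op h D)) (at z within S))"

definition nevanlinna :: "(complex \<Rightarrow> 'a::complex_hilbert_space \<Rightarrow>\<^sub>L 'a) \<Rightarrow> bool" where
  "nevanlinna M \<longleftrightarrow>
    op_holomorphic_on M (- \<real>) \<and>
    (\<forall>l\<in>- \<real>. adj_op (M l) = M (cnj l)) \<and>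
    (\<forall>l\<in>- \<real>. op_nonneg (Im l *\<^sub>R im_op (M l)))"

definition slit_plane :: "complex set" where
  "slit_plane = - (complex_of_real ` ({..-1} \<union> {1..}))"

text \<open>Values outside \<^const>\<open>slit_plane\<close> are unconstrained.\<close>

definition RS :: "(complex \<Rightarrow> 'a::complex_hilbert_space \<Rightarrow>\<^sub>L 'a) set" where
  "RS = {\<Omega>. nevanlinna \<Omega> \<and> op_holomorphic_on \<Omega> slit_plane \<and>
    (\<forall>x\<in>{-1<..<1}. op_le (- id_blinfun) (\<Omega> (complex_of_real x)) \<and>
                    op_le (\<Omega> (complex_of_real x)) id_blinfun)}"

text \<open>The unit circle carries arc length. All its points but the two exceptional ones
  \<open>1\<close> and \<open>-1\<close> lie in \<^const>\<open>slit_plane\<close>, so no boundary limits are involved.\<close>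

definition inner_RS :: "(complex \<Rightarrow> 'a::complex_hilbert_space \<Rightarrow>\<^sub>L 'a) \<Rightarrow> bool" where
  "inner_RS \<Omega> \<longleftrightarrow> \<Omega> \<in> RS \<and> (AE t in lebesgue_on {0..2 * pi}. op_isometric (\<Omega> (cis t)))"

end

theory Submission
  imports Defs "HOL-Complex_Analysis.Complex_Analysis"
begin

text \<open>Morally \<open>\<Omega>(z) = \<integral> b\<^sub>t(z) dE(t)\<close> for a positive operator measure \<open>E\<close> on \<open>[-1, 1]\<close> with
  \<open>E [-1, 1] = I\<close>, where \<open>b\<^sub>t(z) = (z - t) / (1 - t z)\<close>. Only its positivity is needed, and it comes
  from Cauchy's formula on a circle after uniformizing the slit plane by the disc.

  If \<open>w = (z + a) / (1 + a z)\<close>, then \<open>b\<^sub>t(w) - b\<^sub>t(z) = a (1 - b\<^sub>t(z) b\<^sub>t(w))\<close>, so the functional equation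
  says that \<open>\<integral> b\<^sub>t(z) b\<^sub>t(w) dE(t) = \<Omega>(z) \<Omega>(w)\<close>. If \<open>\<Omega>(\<xi>)\<close> is isometric at a point of the
  circle, \<open>\<integral> \<parallel>\<Omega>(\<xi>) x - b\<^sub>t(\<xi>) x\<parallel>\<^sup>2 dE(t) = 0\<close>, and the Cauchy-Schwarz inequality gives this
  multiplicativity on the circle; analytic continuation does the rest.

  Conversely, with \<open>A = \<Omega>(0)\<close>, iterating the functional equation gives
  \<open>\<Omega>(y) = (y + A) (1 + y A)\<^sup>-\<^sup>1\<close> at real points \<open>y\<close> accumulating at \<open>1\<close> and \<open>-1\<close>. Jensen's
  inequality compares \<open>\<Omega>(x)\<close> with \<open>(x + A) (1 + x A)\<^sup>-\<^sup>1\<close> in opposite directions according to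
  the side on which \<open>y\<close> lies, hence \<open>\<Omega>(z) = (z + A) (1 + z A)\<^sup>-\<^sup>1\<close> everywhere, which is inner.\<close>

subsection \<open>The complex scalar product\<close>

lemma cinner_add_right: "cinner x (y + z) = cinner x y + cinner x z"
  by (metis cinner_add_left cinner_commute complex_cnj_add)

lemma scaleC_one [simp]: "1 *\<^sub>C x = x"
  using scaleC_of_real[of 1 x] by simp

lemma scaleC_minus_one: "(-1) *\<^sub>C x = - x"
  using scaleC_of_real[of "-1" x] by simp

lemma cinner_minus_left: "cinner (- x) y = - cinner x y"
  using cinner_scaleC_left[of "-1" x y] by (simp add: scaleC_minus_one)

lemma cinner_minus_right: "cinner x (- y) = - cinner x y"
  using cinner_scaleC_right[of x "-1" y] by (simp add: scaleC_minus_one)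

lemma cinner_diff_left: "cinner (x - y) z = cinner x z - cinner y z"
  using cinner_add_left[of x "- y" z] by (simp add: cinner_minus_left)

lemma cinner_diff_right: "cinner x (y - z) = cinner x y - cinner x z"
  using cinner_add_right[of x y "- z"] by (simp add: cinner_minus_right)

lemma cinner_scaleR_left: "cinner (r *\<^sub>R x) y = of_real r * cinner x y"
  by (metis cinner_scaleC_left scaleC_of_real)

lemma cinner_scaleR_right: "cinner x (r *\<^sub>R y) = of_real r * cinner x y"
  by (metis cinner_scaleC_right scaleC_of_real complex_cnj_complex_of_real)

lemma cinner_zero_left [simp]: "cinner 0 y = 0"
  using cinner_scaleR_left[of 0 0 y] by simp

lemma Im_cinner: "Im (cinner x y) = inner ((- \<i>) *\<^sub>C x) y"
  by (simp add: cinner_scaleC_left flip: Re_cinner)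

lemma bounded_linear_cinner_left: "bounded_linear (\<lambda>x. cinner x y)"
proof (rule bounded_linear_intro)
  have "cmod (cinner x y) \<le> norm x * (2 * norm y)" for x
  proof -
    have "cmod (cinner x y) \<le> \<bar>Re (cinner x y)\<bar> + \<bar>Im (cinner x y)\<bar>"
      by (rule cmod_le)
    also have "\<dots> \<le> norm x * norm y + norm ((- \<i>) *\<^sub>C x) * norm y"
      unfolding Re_cinner Im_cinner by (intro add_mono Cauchy_Schwarz_ineq2)
    finally show ?thesis by (simp add: norm_scaleC)
  qed
  then show "norm (cinner x y) \<le> norm x * (2 * norm y)" for x by simp
qed (auto simp: cinner_add_left cinner_scaleR_left scaleR_conv_of_real)

lemma bounded_linear_cinner_right: "bounded_linear (\<lambda>y. cinner x y)"
proof -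
  have "bounded_linear (\<lambda>y. cnj (cinner y x))"
    by (rule bounded_linear_compose[OF bounded_linear_cnj bounded_linear_cinner_left])
  moreover have "(\<lambda>y. cnj (cinner y x)) = (\<lambda>y. cinner x y)"
    by (auto simp flip: cinner_commute)
  ultimately show ?thesis by simp
qed

lemma cinner_eq_zeroI: "(\<And>y. cinner x y = 0) \<Longrightarrow> x = 0"
  using cinner_self[of x] by simp

lemma cinner_ext: "(\<And>y. cinner a y = cinner b y) \<Longrightarrow> a = b"
  using cinner_eq_zeroI[of "a - b"] by (simp add: cinner_diff_left)

lemmas cinner_simps = cinner_add_left cinner_add_right cinner_diff_left cinner_diff_right
  cinner_minus_left cinner_minus_right cinner_scaleC_left cinner_scaleC_right
  cinner_scaleR_left cinner_scaleR_right

text \<open>Abstracts the values of the operator measure \<open>E\<close>: its density on the circle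
  (\<open>circ_form\<close>) and its atoms at 1 and -1 are both forms of this kind.\<close>

definition pos_form :: "('a::complex_hilbert_space \<Rightarrow> 'a \<Rightarrow> complex) \<Rightarrow> bool" where
  "pos_form \<kappa> \<longleftrightarrow>
    (\<forall>x y z. \<kappa> (x + y) z = \<kappa> x z + \<kappa> y z) \<and> (\<forall>c x y. \<kappa> (c *\<^sub>C x) y = c * \<kappa> x y) \<and>
    (\<forall>x y. \<kappa> x y = cnj (\<kappa> y x)) \<and> (\<forall>x. 0 \<le> Re (\<kappa> x x))"

lemma pos_formD:
  assumes "pos_form \<kappa>"
  shows "\<kappa> (x + y) z = \<kappa> x z + \<kappa> y z" "\<kappa> x (y + z) = \<kappa> x y + \<kappa> x z"
    "\<kappa> (c *\<^sub>C x) y = c * \<kappa> x y" "\<kappa> x (c *\<^sub>C y) = cnj c * \<kappa> x y"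
    "\<kappa> x y = cnj (\<kappa> y x)" "0 \<le> Re (\<kappa> x x)"
  using assms unfolding pos_form_def by (blast, metis complex_cnj_add, blast,
    metis complex_cnj_mult, blast, blast)

subsection \<open>The slit plane\<close>

lemma slit_plane_iff: "z \<in> slit_plane \<longleftrightarrow> (Im z = 0 \<longrightarrow> \<bar>Re z\<bar> < 1)"
proof -
  have "z \<in> complex_of_real ` ({..-1} \<union> {1..}) \<longleftrightarrow> Im z = 0 \<and> 1 \<le> \<bar>Re z\<bar>"
    by (auto simp: image_iff complex_eq_iff abs_if split: if_splits)
  then show ?thesis unfolding slit_plane_def by auto
qed

lemma zero_in_slit_plane: "0 \<in> slit_plane"
  by (simp add: slit_plane_iff)

lemma cnj_in_slit_plane: "z \<in> slit_plane \<Longrightarrow> cnj z \<in> slit_plane"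
  by (simp add: slit_plane_iff)

lemma of_real_in_slit_plane: "\<bar>x\<bar> < 1 \<Longrightarrow> of_real x \<in> slit_plane"
  by (simp add: slit_plane_iff)

lemma open_slit_plane: "open slit_plane"
proof -
  have "complex_of_real ` ({..-1} \<union> {1..}) = \<real> \<inter> ({z. Re z \<le> -1} \<union> {z. 1 \<le> Re z})"
    by (auto simp: image_iff Reals_def)
  moreover have "closed \<dots>"
    by (intro closed_Int closed_Un closed_complex_Reals closed_halfspace_Re_le closed_halfspace_Re_ge)
  ultimately have "closed (complex_of_real ` ({..-1} \<union> {1..}))" by (simp only:)
  then show ?thesis unfolding slit_plane_def by (rule open_Compl)
qed

lemma scaled_in_slit_plane:
  assumes "z \<in> slit_plane" "0 \<le> r" "r \<le> 1"
  shows "of_real r * z \<in> slit_plane"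
proof -
  have "r * \<bar>Re z\<bar> \<le> \<bar>Re z\<bar>" using assms by (simp add: mult_left_le_one_le)
  then show ?thesis using assms by (auto simp: slit_plane_iff abs_mult)
qed

lemma connected_slit_plane: "connected slit_plane"
proof (rule starlike_imp_connected)
  have "closed_segment 0 z \<subseteq> slit_plane" if "z \<in> slit_plane" for z
  proof
    fix x assume "x \<in> closed_segment 0 z"
    then obtain r where "0 \<le> r" "r \<le> 1" "x = of_real r * z"
      by (auto simp: closed_segment_def scaleR_conv_of_real)
    with that show "x \<in> slit_plane" using scaled_in_slit_plane by blast
  qed
  then show "starlike slit_plane"
    unfolding starlike_def using zero_in_slit_plane by blast
qed

text \<open>The reciprocal of the Zhukovsky map \<open>(u + 1 / u) / 2\<close>: it takes the unit disc conformally onto the slit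
  plane, respecting the upper and the lower half-planes.\<close>

definition zhuk :: "complex \<Rightarrow> complex" where
  "zhuk u = 2 * u / (1 + u\<^sup>2)"

text \<open>The branch of the inverse with values in the disc. Compared with
  \<open>(1 - csqrt (1 - z\<^sup>2)) / z\<close>, this form makes no exception of 0.\<close>

definition zhuk_inv :: "complex \<Rightarrow> complex" where
  "zhuk_inv z = z / (1 + csqrt (1 - z\<^sup>2))"

lemma one_plus_square_nonzero: "cmod u < 1 \<Longrightarrow> 1 + u\<^sup>2 \<noteq> 0"
proof
  assume "cmod u < 1" "1 + u\<^sup>2 = 0"
  then have "u\<^sup>2 = -1" by (simp add: add_eq_0_iff)
  then have "(cmod u)\<^sup>2 = 1" by (metis norm_minus_cancel norm_one norm_power)
  moreover have "(cmod u)\<^sup>2 < 1" using \<open>cmod u < 1\<close> by (simp add: abs_square_less_1)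
  ultimately show False by simp
qed

lemma Im_zhuk:
  "Im (zhuk u) = Im u * (2 * (1 - (cmod u)\<^sup>2) / (cmod (1 + u\<^sup>2))\<^sup>2)"
proof -
  have "Im (zhuk u) = Im (2 * u * cnj (1 + u\<^sup>2)) / (cmod (1 + u\<^sup>2))\<^sup>2"
    unfolding zhuk_def by (simp add: complex_div_cnj[of "2*u"] flip: of_real_power)
  also have "Im (2 * u * cnj (1 + u\<^sup>2)) = Im u * (2 * (1 - (cmod u)\<^sup>2))"
    unfolding cmod_power2 by (simp add: power2_eq_square algebra_simps)
  finally show ?thesis by simp
qed

lemma Im_zhuk_pos: "cmod u < 1 \<Longrightarrow> \<exists>k>0. Im (zhuk u) = Im u * k"
  using one_plus_square_nonzero[of u]
  by (intro exI[of _ "2 * (1 - (cmod u)\<^sup>2) / (cmod (1 + u\<^sup>2))\<^sup>2"])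
     (simp add: Im_zhuk power_less_one_iff abs_square_less_1)

lemma zhuk_of_real: "zhuk (of_real x) = of_real (2 * x / (1 + x\<^sup>2))"
  by (simp add: zhuk_def)

lemma zhuk_real_less_one: "\<bar>x\<bar> < 1 \<Longrightarrow> \<bar>2 * x / (1 + x\<^sup>2)\<bar> < (1::real)"
proof -
  assume "\<bar>x\<bar> < 1"
  then have "0 < (1 - \<bar>x\<bar>)\<^sup>2" by simp
  then have "2 * \<bar>x\<bar> < 1 + x\<^sup>2" by (simp add: power2_diff)
  then show ?thesis by (simp add: abs_mult abs_div_pos add_pos_nonneg)
qed

lemma zhuk_in_slit_plane:
  assumes "cmod u < 1" shows "zhuk u \<in> slit_plane"
proof (cases "Im u = 0")
  case True
  then have "u = of_real (Re u)" by (simp add: complex_eq_iff)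
  moreover have "\<bar>Re u\<bar> < 1" using assms abs_Re_le_cmod[of u] by linarith
  ultimately show ?thesis
    by (metis of_real_in_slit_plane zhuk_of_real zhuk_real_less_one)
next
  case False
  then show ?thesis using Im_zhuk_pos[OF assms] by (auto simp: slit_plane_iff)
qed

text \<open>Keeps \<open>1 - z\<^sup>2\<close> off the branch cut of \<open>csqrt\<close>, which
  gives both the continuity of \<open>zhuk_inv\<close> and a strictly positive real part of the
  root.\<close>

lemma one_minus_square_slit:
  assumes "z \<in> slit_plane" shows "1 - z\<^sup>2 \<notin> \<real>\<^sub>\<le>\<^sub>0"
proof
  assume "1 - z\<^sup>2 \<in> \<real>\<^sub>\<le>\<^sub>0"
  then have *: "Re z * Im z = 0" "1 \<le> (Re z)\<^sup>2 - (Im z)\<^sup>2"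
    by (auto simp: complex_nonpos_Reals_iff power2_eq_square)
  show False
  proof (cases "Im z = 0")
    case True
    then have "1 \<le> (Re z)\<^sup>2" using * by simp
    then have "1 \<le> \<bar>Re z\<bar>" using abs_le_square_iff[of 1 "Re z"] by simp
    with assms True show False by (simp add: slit_plane_iff)
  next
    case False
    with * have "1 \<le> - (Im z)\<^sup>2" by simp
    then show False using zero_le_power2[of "Im z"] by linarith
  qed
qed

lemma Re_csqrt_slit:
  assumes "z \<in> slit_plane" shows "0 < Re (csqrt (1 - z\<^sup>2))"
proof (rule ccontr)
  define s where "s = csqrt (1 - z\<^sup>2)"
  assume "\<not> 0 < Re (csqrt (1 - z\<^sup>2))"
  then have "Re s = 0" using Re_csqrt[of "1 - z\<^sup>2"] by (simp add: s_def)
  then have "Re (s\<^sup>2) \<le> 0" "Im (s\<^sup>2) = 0" by (simp_all add: power2_eq_square)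
  moreover have "s\<^sup>2 = 1 - z\<^sup>2" by (simp add: s_def)
  ultimately show False
    using one_minus_square_slit[OF assms] by (simp add: complex_nonpos_Reals_iff)
qed

lemma csqrt_plus_one_nonzero: "1 + csqrt w \<noteq> 0"
proof
  assume "1 + csqrt w = 0"
  then have "Re (1 + csqrt w) = 0" by simp
  then have "Re (csqrt w) = - 1" by (simp del: csqrt.sel)
  then show False using Re_csqrt[of w] by linarith
qed

text \<open>With \<open>s = csqrt (1 - z\<^sup>2)\<close> the square of \<open>zhuk_inv z\<close> is
  \<open>(1 - s) / (1 + s)\<close>, a Cayley transform, and it lies in the disc because
  \<open>Re s > 0\<close>.\<close>

lemma zhuk_zhuk_inv:
  assumes "z \<in> slit_plane" shows "cmod (zhuk_inv z) < 1" "zhuk (zhuk_inv z) = z"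
proof -
  define s where "s = csqrt (1 - z\<^sup>2)"
  have s: "s\<^sup>2 = 1 - z\<^sup>2" and Re: "0 < Re s"
    using Re_csqrt_slit[OF assms] by (auto simp: s_def)
  have nz: "1 + s \<noteq> 0" unfolding s_def by (rule csqrt_plus_one_nonzero)
  have p: "zhuk_inv z = z / (1 + s)" by (simp add: zhuk_inv_def s_def)
  have "z\<^sup>2 = (1 - s) * (1 + s)" using s by (simp add: power2_eq_square algebra_simps)
  then have p2: "(zhuk_inv z)\<^sup>2 = (1 - s) / (1 + s)"
    using nz by (simp add: p power_divide power2_eq_square)
  have "(cmod (1 - s))\<^sup>2 < (cmod (1 + s))\<^sup>2"
    using Re unfolding cmod_power2 by (simp add: power2_eq_square algebra_simps)
  then have "cmod (1 - s) < cmod (1 + s)" by (simp add: power2_less_imp_less)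
  then have "(cmod (zhuk_inv z))\<^sup>2 < 1"
    using nz unfolding norm_power[symmetric] p2 by (simp add: norm_divide)
  then show "cmod (zhuk_inv z) < 1" by (simp add: power_less_one_iff abs_square_less_1)
  have "1 + (zhuk_inv z)\<^sup>2 = 2 / (1 + s)" using nz by (simp add: p2 field_simps)
  then show "zhuk (zhuk_inv z) = z" using nz by (simp add: zhuk_def p)
qed

lemma isCont_zhuk_inv: "z \<in> slit_plane \<Longrightarrow> isCont zhuk_inv z"
proof -
  assume "z \<in> slit_plane"
  then have "isCont csqrt (1 - z\<^sup>2)"
    by (intro continuous_at_csqrt one_minus_square_slit)
  moreover have "isCont (\<lambda>z. 1 - z\<^sup>2) z" by simp
  ultimately have "isCont (\<lambda>z. csqrt (1 - z\<^sup>2)) z"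
    by (rule isCont_o2[rotated])
  then show ?thesis
    unfolding zhuk_inv_def by (intro continuous_intros csqrt_plus_one_nonzero)
qed

lemma isCont_zhuk: "cmod u < 1 \<Longrightarrow> isCont zhuk u"
  unfolding zhuk_def using one_plus_square_nonzero[of u] by (intro continuous_intros) auto

subsection \<open>Functions of the class RS\<close>

lemma RS_complex_linear:
  assumes "\<Omega> \<in> RS" "z \<in> slit_plane"
  shows "blinfun_apply (\<Omega> z) (c *\<^sub>C x) = c *\<^sub>C blinfun_apply (\<Omega> z) x"
  using assms by (auto simp: RS_def op_holomorphic_on_def bounded_ops_def)

lemma RS_isCont:
  assumes "\<Omega> \<in> RS" "z \<in> slit_plane"
  shows "isCont \<Omega> z"
proof -
  obtain D where "(\<Omega> has_derivative (\<lambda>h. scaleC_op h D)) (at z within slit_plane)"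
    using assms by (auto simp: RS_def op_holomorphic_on_def)
  then have "(\<Omega> has_derivative (\<lambda>h. scaleC_op h D)) (at z)"
    using at_within_open[OF assms(2) open_slit_plane] by simp
  then show ?thesis by (rule has_derivative_continuous)
qed

lemma bounded_linear_cinner_blinfun_left: "bounded_linear (\<lambda>T. cinner (blinfun_apply T x) y)"
  by (rule bounded_linear_compose[OF bounded_linear_cinner_left])
     (rule blinfun.bounded_linear_left)

lemma bounded_linear_cinner_blinfun_right: "bounded_linear (\<lambda>T. cinner x (blinfun_apply T y))"
  by (rule bounded_linear_compose[OF bounded_linear_cinner_right])
     (rule blinfun.bounded_linear_left)

text \<open>Reduces holomorphy in the operator norm to scalar functions; Cauchy's formula and the
  identity theorem are applied to combinations of these.\<close>

lemma RS_cinner_holomorphic: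
  assumes "\<Omega> \<in> RS"
  shows "(\<lambda>z. cinner (blinfun_apply (\<Omega> z) x) y) holomorphic_on slit_plane"
  unfolding holomorphic_on_def
proof
  fix z assume z: "z \<in> slit_plane"
  obtain D where D: "(\<Omega> has_derivative (\<lambda>h. scaleC_op h D)) (at z within slit_plane)"
    using assms z by (auto simp: RS_def op_holomorphic_on_def)
  have "((\<lambda>z. cinner (blinfun_apply (\<Omega> z) x) y) has_derivative
      (\<lambda>h. cinner (blinfun_apply (scaleC_op h D) x) y)) (at z within slit_plane)"
    by (rule bounded_linear.has_derivative[OF bounded_linear_cinner_blinfun_left D])
  moreover have "(\<lambda>h. cinner (blinfun_apply (scaleC_op h D) x) y)
      = (*) (cinner (blinfun_apply D x) y)"
    by (auto simp: scaleC_op.rep_eq cinner_scaleC_left)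
  ultimately have "((\<lambda>z. cinner (blinfun_apply (\<Omega> z) x) y) has_field_derivative
      cinner (blinfun_apply D x) y) (at z within slit_plane)"
    by (simp add: has_field_derivative_def)
  then show "(\<lambda>z. cinner (blinfun_apply (\<Omega> z) x) y) field_differentiable at z within slit_plane"
    by (auto simp: field_differentiable_def)
qed

text \<open>Off the real axis this is part of the Nevanlinna property. At real points of the slit
  plane it follows by continuity, approaching \<open>z\<close> along
  \<open>z + \<i> / (n + 1)\<close>.\<close>

lemma RS_adjoint:
  assumes "\<Omega> \<in> RS" "z \<in> slit_plane"
  shows "cinner (blinfun_apply (\<Omega> z) x) y = cinner x (blinfun_apply (\<Omega> (cnj z)) y)"
proof (cases "Im z = 0")
  case False
  then have "z \<in> - \<real>" by (auto simp: complex_is_Real_iff)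
  then have "\<Omega> z \<in> bounded_ops" "adj_op (\<Omega> z) = \<Omega> (cnj z)"
    using assms(1) by (auto simp: RS_def nevanlinna_def op_holomorphic_on_def)
  then show ?thesis using cinner_adj_op by metis
next
  case True
  define w where "w n = z + \<i> * of_real (inverse (real (Suc n)))" for n
  have "w \<longlonglongrightarrow> z + \<i> * of_real 0"
    unfolding w_def by (intro tendsto_intros LIMSEQ_inverse_real_of_nat)
  then have w: "w \<longlonglongrightarrow> z" by simp
  then have cw: "(\<lambda>n. cnj (w n)) \<longlonglongrightarrow> cnj z" by (rule tendsto_cnj)
  have "(\<lambda>n. \<Omega> (w n)) \<longlonglongrightarrow> \<Omega> z"
    by (rule isCont_tendsto_compose[OF RS_isCont[OF assms] w])
  then have 1: "(\<lambda>n. cinner (blinfun_apply (\<Omega> (w n)) x) y) \<longlonglongrightarrow> cinner (blinfun_apply (\<Omega> z) x) y"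
    by (rule bounded_linear.tendsto[OF bounded_linear_cinner_blinfun_left])
  have "(\<lambda>n. \<Omega> (cnj (w n))) \<longlonglongrightarrow> \<Omega> (cnj z)"
    by (rule isCont_tendsto_compose[OF RS_isCont[OF assms(1) cnj_in_slit_plane[OF assms(2)]] cw])
  then have 2: "(\<lambda>n. cinner x (blinfun_apply (\<Omega> (cnj (w n))) y)) \<longlonglongrightarrow> cinner x (blinfun_apply (\<Omega> (cnj z)) y)"
    by (rule bounded_linear.tendsto[OF bounded_linear_cinner_blinfun_right])
  have "cinner (blinfun_apply (\<Omega> (w n)) x) y = cinner x (blinfun_apply (\<Omega> (cnj (w n))) y)" for n
  proof -
    have "Im (w n) \<noteq> 0" using True by (simp add: w_def)
    then have "w n \<in> - \<real>" by (auto simp: complex_is_Real_iff)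
    then have "\<Omega> (w n) \<in> bounded_ops" "adj_op (\<Omega> (w n)) = \<Omega> (cnj (w n))"
      using assms(1) by (auto simp: RS_def nevanlinna_def op_holomorphic_on_def)
    then show ?thesis using cinner_adj_op by metis
  qed
  then show ?thesis using LIMSEQ_unique[OF 1] 2 by simp
qed

lemma RS_Im_nonneg:
  assumes "\<Omega> \<in> RS"
  shows "0 \<le> Im z * Im (cinner (blinfun_apply (\<Omega> z) x) x)"
proof (cases "Im z = 0")
  case False
  then have z: "z \<in> - \<real>" by (auto simp: complex_is_Real_iff)
  then have b: "\<Omega> z \<in> bounded_ops"
    and "op_nonneg (Im z *\<^sub>R im_op (\<Omega> z))"
    using assms by (auto simp: RS_def nevanlinna_def op_holomorphic_on_def)
  then have "0 \<le> Re (cinner (blinfun_apply (Im z *\<^sub>R im_op (\<Omega> z)) x) x)"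
    by (auto simp: op_nonneg_def)
  also have "cinner (blinfun_apply (adj_op (\<Omega> z)) x) x = cnj (cinner (blinfun_apply (\<Omega> z) x) x)"
    by (metis b cinner_adj_op cinner_commute)
  then have "Re (cinner (blinfun_apply (Im z *\<^sub>R im_op (\<Omega> z)) x) x)
     = Im z * Im (cinner (blinfun_apply (\<Omega> z) x) x)"
    by (simp add: im_op_def scaleC_op.rep_eq blinfun.scaleR_left blinfun.diff_left cinner_simps
        Re_divide Im_divide)
  finally show ?thesis .
qed simp

lemma RS_real_bounds:
  assumes "\<Omega> \<in> RS" "\<bar>s\<bar> < 1"
  shows "0 \<le> Re (cinner x x + cinner (blinfun_apply (\<Omega> (of_real s)) x) x)"
    "0 \<le> Re (cinner x x - cinner (blinfun_apply (\<Omega> (of_real s)) x) x)"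
proof -
  have "s \<in> {-1<..<1}" using assms(2) by auto
  then have "op_nonneg (\<Omega> (of_real s) - - id_blinfun)" "op_nonneg (id_blinfun - \<Omega> (of_real s))"
    using assms(1) unfolding RS_def op_le_def by blast+
  then show "0 \<le> Re (cinner x x + cinner (blinfun_apply (\<Omega> (of_real s)) x) x)"
    "0 \<le> Re (cinner x x - cinner (blinfun_apply (\<Omega> (of_real s)) x) x)"
    by (auto simp: op_nonneg_def blinfun.diff_left blinfun.minus_left blinfun.add_left cinner_simps
        add.commute)
qed

subsection \<open>Positivity\<close>

lemma holomorphic_zhuk: "zhuk holomorphic_on ball 0 1"
  unfolding zhuk_def using one_plus_square_nonzero by (intro holomorphic_intros) auto

text \<open>On the circle \<open>cnj v = 1 / v\<close>, so \<open>Im v\<close> and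
  \<open>Re v\<close> are rational in \<open>v\<close>, and \<open>1 - zhuk p * Re v\<close> factors
  as \<open>(v - p) * (1 - p * v) / ((1 + p\<^sup>2) * v)\<close>. Only the zero at \<open>p\<close>
  lies in the disc, and Cauchy's formula evaluates the integral.\<close>

lemma circle_kernel_integral:
  assumes g: "g holomorphic_on ball 0 R" and R: "1 < R" and p: "cmod p < 1"
  shows "((\<lambda>s. g (circlepath 0 1 s) * of_real (Im (circlepath 0 1 s)) *
      (zhuk p / (1 - zhuk p * of_real (Re (circlepath 0 1 s))))) has_integral
      \<i> * (g p - g 0)) {0..1}"
proof -
  \<comment> \<open>The numerator collects everything regular on the closed disc. At
    \<open>p\<close> and at 0 the factor of \<open>g\<close> equals -1, so
    \<open>h p = - g p\<close> and \<open>h 0 = - g 0\<close>.\<close>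
  define h where "h v = g v * (v\<^sup>2 - 1) / (1 - p * v)" for v
  have nz: "1 - p * v \<noteq> 0" if "cmod v \<le> 1" for v
  proof
    assume "1 - p * v = 0"
    then have "cmod (p * v) = 1" by simp
    moreover have "cmod (p * v) \<le> cmod p * 1"
      unfolding norm_mult using that by (intro mult_left_mono) auto
    ultimately show False using p by simp
  qed
  have "g holomorphic_on cball 0 1"
    using g R by (rule_tac holomorphic_on_subset) auto
  then have hol: "h holomorphic_on cball 0 1"
    unfolding h_def using nz by (intro holomorphic_intros) auto
  have ci: "((\<lambda>u. h u / (u - w)) has_contour_integral (2 * of_real pi * \<i> * h w)) (circlepath 0 1)"
    if "cmod w < 1" for w
    using Cauchy_integral_circlepath[of 0 1 h w] hol that
      holomorphic_on_imp_continuous_on holomorphic_on_subset[OF hol ball_subset_cball]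
    by (auto simp: dist_norm)
  \<comment> \<open>The difference of the two Cauchy kernels is \<open>p / (u * (u - p))\<close>;
    its factor \<open>1 / u\<close> cancels the \<open>u\<close> in
    \<open>du = 2 \<pi> \<i> u ds\<close>.\<close>
  have "((\<lambda>u. h u / (u - p) - h u / (u - 0)) has_contour_integral
      (2 * of_real pi * \<i> * h p - 2 * of_real pi * \<i> * h 0)) (circlepath 0 1)"
    by (intro has_contour_integral_diff ci p) simp
  moreover have "h 0 = - g 0" by (simp add: h_def)
  moreover have "h p = - g p"
    using nz[of p] p by (simp add: h_def power2_eq_square divide_simps) (simp add: algebra_simps)
  ultimately have "((\<lambda>u. h u / (u - p) - h u / u) has_contour_integral
      (2 * of_real pi * \<i> * (g 0 - g p))) (circlepath 0 1)"
    by (simp add: algebra_simps)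
  then have "((\<lambda>s. (h (circlepath 0 1 s) / (circlepath 0 1 s - p) -
        h (circlepath 0 1 s) / circlepath 0 1 s) *
      vector_derivative (circlepath 0 1) (at s within {0..1})) has_integral
      (2 * of_real pi * \<i> * (g 0 - g p))) {0..1}"
    by (simp add: has_contour_integral_def)
  note I = this
  have e: "- 1 / (2 * of_real pi) * (2 * of_real pi * \<i> * (g 0 - g p)) = \<i> * (g p - g 0)"
    by (simp add: field_simps)
  have "((\<lambda>s. - 1 / (2 * of_real pi) * ((h (circlepath 0 1 s) / (circlepath 0 1 s - p) -
        h (circlepath 0 1 s) / circlepath 0 1 s) *
      vector_derivative (circlepath 0 1) (at s within {0..1}))) has_integral
      \<i> * (g p - g 0)) {0..1}"
    using has_integral_mult_right[OF I, of "- 1 / (2 * of_real pi)"] unfolding e .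
  moreover have "- 1 / (2 * of_real pi) * ((h (circlepath 0 1 s) / (circlepath 0 1 s - p) -
        h (circlepath 0 1 s) / circlepath 0 1 s) *
      vector_derivative (circlepath 0 1) (at s within {0..1})) =
      g (circlepath 0 1 s) * of_real (Im (circlepath 0 1 s)) *
      (zhuk p / (1 - zhuk p * of_real (Re (circlepath 0 1 s))))" if "s \<in> {0..1}" for s
  proof -
    define v where "v = circlepath 0 1 s"
    have v: "cmod v = 1" by (simp add: v_def circlepath)
    have cnj_v: "cnj v * v = 1" using complex_norm_square[of v] v by (simp add: mult.commute)
    have v0: "v \<noteq> 0" using v by auto
    have vp: "v - p \<noteq> 0" using v p by auto
    have d: "vector_derivative (circlepath 0 1) (at s within {0..1}) = 2 * of_real pi * \<i> * v"
      using that by (subst vector_derivative_circlepath01) (auto simp: v_def circlepath)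
    have im: "of_real (Im v) = (v\<^sup>2 - 1) / (2 * \<i> * v)"
    proof -
      have "2 * \<i> * of_real (Im v) = v - cnj v" by (simp add: complex_diff_cnj)
      then have "2 * \<i> * of_real (Im v) * v = v * v - cnj v * v"
        by (simp only: left_diff_distrib)
      then have "2 * \<i> * of_real (Im v) * v = v\<^sup>2 - 1"
        by (simp only: cnj_v power2_eq_square)
      then show ?thesis using v0 by (simp add: field_simps)
    qed
    have re: "of_real (Re v) = (v\<^sup>2 + 1) / (2 * v)"
    proof -
      have "2 * of_real (Re v) = v + cnj v" by (simp add: complex_add_cnj)
      then have "2 * of_real (Re v) * v = v * v + cnj v * v"
        by (simp only: distrib_right)
      then have "2 * of_real (Re v) * v = v\<^sup>2 + 1"
        by (simp only: cnj_v power2_eq_square)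
      then show ?thesis using v0 by (simp add: field_simps)
    qed
    have p1: "1 + p\<^sup>2 \<noteq> 0" by (rule one_plus_square_nonzero[OF p])
    have pv: "1 - p * v \<noteq> 0" using nz[of v] v by simp
    have "1 - zhuk p * of_real (Re v) = (v - p) * (1 - p * v) / ((1 + p\<^sup>2) * v)"
      unfolding re zhuk_def using p1 v0 by (simp add: divide_simps) (simp add: power2_eq_square algebra_simps)
    then have zz: "zhuk p / (1 - zhuk p * of_real (Re v)) = 2 * p * v / ((v - p) * (1 - p * v))"
      using p1 v0 vp pv by (simp add: zhuk_def)
    have "h v / (v - p) - h v / v = h v * p / (v * (v - p))"
      using v0 vp by (simp add: divide_simps) (simp add: algebra_simps)
    also have "- 1 / (2 * of_real pi) * (h v * p / (v * (v - p)) * (2 * of_real pi * \<i> * v))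
       = - \<i> * (h v * p / (v - p))"
      using v0 by simp
    also have "\<dots> = g v * ((v\<^sup>2 - 1) / (2 * \<i> * v)) * (2 * p * v / ((v - p) * (1 - p * v)))"
      using v0 vp pv by (simp add: h_def divide_simps)
    finally show ?thesis
      unfolding d unfolding v_def[symmetric] im zz .
  qed
  ultimately show ?thesis
    by (rule has_integral_eq[rotated])
qed


text \<open>The imaginary part of \<Omega> as a form, taken on the image under \<open>zhuk\<close>
  of the circle of radius \<open>r\<close>. Folding the circle onto \<open>[-1, 1]\<close> by
  \<open>v \<mapsto> Re v\<close> makes it a density of the representing measure.\<close>

definition circ_form ::
  "(complex \<Rightarrow> 'a::complex_hilbert_space \<Rightarrow>\<^sub>L 'a) \<Rightarrow> real \<Rightarrow> complex \<Rightarrow> 'a \<Rightarrow> 'a \<Rightarrow> complex" where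
  "circ_form \<Omega> r v x y = of_real (Im v) *
    ((cinner (blinfun_apply (\<Omega> (zhuk (of_real r * v))) x) y
      - cinner x (blinfun_apply (\<Omega> (zhuk (of_real r * v))) y)) / (2 * \<i>))"

text \<open>The point \<open>zhuk (r v)\<close> lies in the same half-plane as \<open>v\<close>, so
  the factor \<open>Im v\<close> compensates the sign of the imaginary part of \<Omega> there, which
  the Nevanlinna property controls.\<close>

lemma pos_form_circ_form:
  assumes \<Omega>: "\<Omega> \<in> RS" and r: "0 < r" "r < 1" and v: "cmod v = 1"
  shows "pos_form (circ_form \<Omega> r v)"
proof -
  define z where "z = zhuk (of_real r * v)"
  have rv: "cmod (of_real r * v) < 1" using r v by (simp add: norm_mult)
  then have z: "z \<in> slit_plane" unfolding z_def by (rule zhuk_in_slit_plane)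
  obtain k where k: "k > 0" "Im z = r * Im v * k"
    using Im_zhuk_pos[OF rv] by (auto simp: z_def)
  have "0 \<le> Re (circ_form \<Omega> r v x x)" for x
  proof -
    let ?a = "cinner (blinfun_apply (\<Omega> z) x) x"
    have "circ_form \<Omega> r v x x = of_real (Im v) * ((?a - cnj ?a) / (2 * \<i>))"
      unfolding circ_form_def z_def[symmetric] by (metis cinner_commute)
    then have "Re (circ_form \<Omega> r v x x) = Im v * Im ?a"
      by (simp add: complex_diff_cnj)
    moreover have "0 \<le> (r * k) * (Im v * Im ?a)"
      using RS_Im_nonneg[OF \<Omega>, of z x] k by (simp add: mult_ac)
    moreover have "0 < r * k" using r k by simp
    ultimately show ?thesis by (metis zero_le_mult_iff not_less)
  qed
  moreover have "circ_form \<Omega> r v x y = cnj (circ_form \<Omega> r v y x)" for x y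
  proof -
    have "cnj (cinner (blinfun_apply (\<Omega> z) y) x) = cinner x (blinfun_apply (\<Omega> z) y)"
      "cnj (cinner y (blinfun_apply (\<Omega> z) x)) = cinner (blinfun_apply (\<Omega> z) x) y"
      by (metis cinner_commute)+
    moreover have "cnj (of_real s * ((a - b) / (2 * \<i>))) = of_real s * ((cnj b - cnj a) / (2 * \<i>))"
      for s a b by (simp add: complex_eq_iff right_diff_distrib)
    ultimately show ?thesis
      unfolding circ_form_def z_def[symmetric] by presburger
  qed
  ultimately show ?thesis
    unfolding pos_form_def circ_form_def z_def[symmetric]
    by (simp_all add: cinner_simps blinfun.add_right RS_complex_linear[OF \<Omega> z] add_divide_distrib
        diff_divide_distrib algebra_simps)
qed

text \<open>The kernel integral alone recovers \<open>g p - g 0\<close> from \<open>g\<close>.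
  Subtracting its conjugated counterpart replaces \<open>g\<close> by its imaginary part, which is
  the positive quantity; the symmetry of \<Omega> makes the two contributions equal.\<close>

lemma circ_form_integral:
  assumes \<Omega>: "\<Omega> \<in> RS" and r: "0 < r" "r < 1" and p: "cmod p < 1"
  shows "((\<lambda>s. circ_form \<Omega> r (circlepath 0 1 s) x y *
      (zhuk p / (1 - zhuk p * of_real (Re (circlepath 0 1 s))))) has_integral
      cinner (blinfun_apply (\<Omega> (zhuk (of_real r * p))) x) y
      - cinner (blinfun_apply (\<Omega> 0) x) y) {0..1}"
proof -
  define g where "g x y v = cinner (blinfun_apply (\<Omega> (zhuk (of_real r * v))) x) y" for x y v
  have g_hol: "g x y holomorphic_on ball 0 (1 / r)" for x y
  proof -
    have rv: "cmod (of_real r * v) < 1" if "v \<in> ball 0 (1/r)" for v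
      using r that by (auto simp: norm_mult field_simps)
    then have "(\<lambda>v. of_real r * v) ` ball 0 (1 / r) \<subseteq> ball (0::complex) 1"
      by auto
    then have "(zhuk \<circ> (\<lambda>v. of_real r * v)) holomorphic_on ball 0 (1 / r)"
      by (intro holomorphic_on_compose_gen[OF _ holomorphic_zhuk] holomorphic_intros) auto
    moreover have "(zhuk \<circ> (\<lambda>v. of_real r * v)) ` ball 0 (1 / r) \<subseteq> slit_plane"
      using rv by (auto intro!: zhuk_in_slit_plane)
    ultimately have "((\<lambda>z. cinner (blinfun_apply (\<Omega> z) x) y) \<circ> (zhuk \<circ> (\<lambda>v. of_real r * v)))
        holomorphic_on ball 0 (1 / r)"
      by (rule holomorphic_on_compose_gen[OF _ RS_cinner_holomorphic[OF \<Omega>]])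
    then show ?thesis by (simp add: o_def g_def[abs_def])
  qed
  have R: "1 < 1 / r" using r by simp
  have sym: "cnj (g y x (cnj v)) = g x y v" if "cmod v < 1" for v
  proof -
    have "cmod (of_real r * v) < 1"
      using r that mult_strict_mono[of r 1 "cmod v" 1] by (simp add: norm_mult)
    then have "zhuk (of_real r * v) \<in> slit_plane" by (rule zhuk_in_slit_plane)
    moreover have "zhuk (of_real r * cnj v) = cnj (zhuk (of_real r * v))" by (simp add: zhuk_def)
    ultimately show ?thesis
      using RS_adjoint[OF \<Omega>] unfolding g_def by (metis cinner_commute)
  qed
  \<comment> \<open>Starting from \<open>cnj p\<close> and conjugating restores the kernel of
    \<open>p\<close> but turns \<i> into -\<i>, so that the later subtraction doubles the
    value.\<close>
  have "zhuk (cnj p) = cnj (zhuk p)" by (simp add: zhuk_def)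
  then have "((\<lambda>s. g y x (circlepath 0 1 s) * of_real (Im (circlepath 0 1 s)) *
      (cnj (zhuk p) / (1 - cnj (zhuk p) * of_real (Re (circlepath 0 1 s))))) has_integral
      \<i> * (g y x (cnj p) - g y x 0)) {0..1}"
    using circle_kernel_integral[OF g_hol[of y x] R, of "cnj p"] p by simp
  from has_integral_linear[OF this bounded_linear_cnj]
  have "((\<lambda>s. cnj (g y x (circlepath 0 1 s) * of_real (Im (circlepath 0 1 s)) *
      (cnj (zhuk p) / (1 - cnj (zhuk p) * of_real (Re (circlepath 0 1 s)))))) has_integral
      cnj (\<i> * (g y x (cnj p) - g y x 0))) {0..1}"
    by (simp only: o_def)
  then have "((\<lambda>s. cnj (g y x (circlepath 0 1 s)) * of_real (Im (circlepath 0 1 s)) *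
      (zhuk p / (1 - zhuk p * of_real (Re (circlepath 0 1 s))))) has_integral
      - \<i> * (g x y p - g x y 0)) {0..1}"
    using sym[OF p] sym[of 0] by simp
  from has_integral_mult_left[OF has_integral_diff[OF
      circle_kernel_integral[OF g_hol[of x y] R p] this], of "1 / (2 * \<i>)"]
  have "((\<lambda>s. (g x y (circlepath 0 1 s) * of_real (Im (circlepath 0 1 s)) *
      (zhuk p / (1 - zhuk p * of_real (Re (circlepath 0 1 s)))) -
      cnj (g y x (circlepath 0 1 s)) * of_real (Im (circlepath 0 1 s)) *
      (zhuk p / (1 - zhuk p * of_real (Re (circlepath 0 1 s))))) * (1 / (2 * \<i>)))
      has_integral (g x y p - g x y 0)) {0..1}"
    by (simp add: algebra_simps)
  moreover have "circ_form \<Omega> r v x y * c = (g x y v * of_real (Im v) * c -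
      cnj (g y x v) * of_real (Im v) * c) * (1 / (2 * \<i>))" for v c
    unfolding circ_form_def g_def by (subst cinner_commute[of x]) (simp add: field_simps)
  moreover have "g x y 0 = cinner (blinfun_apply (\<Omega> 0) x) y" by (simp add: g_def zhuk_def)
  moreover have "g x y p = cinner (blinfun_apply (\<Omega> (zhuk (of_real r * p))) x) y" by (simp only: g_def)
  ultimately show ?thesis by (simp only:)
qed

section \<open>Combinations of the functions b_t and their positivity\<close>

definition mob :: "real \<Rightarrow> complex \<Rightarrow> complex" where
  "mob t z = (z - of_real t) / (1 - of_real t * z)"

lemma mob_denominator:
  assumes "z \<in> slit_plane" "\<bar>t\<bar> \<le> 1" shows "1 - of_real t * z \<noteq> 0"
proof
  assume *: "1 - of_real t * z = 0"
  then have "t * Im z = 0" "1 = t * Re z" by (auto simp: complex_eq_iff)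
  then have "Im z = 0" "\<bar>t\<bar> * \<bar>Re z\<bar> = 1" by (auto simp flip: abs_mult)
  moreover from this assms(1) have "\<bar>Re z\<bar> < 1" by (simp add: slit_plane_iff)
  moreover have "\<bar>t\<bar> * \<bar>Re z\<bar> \<le> 1 * \<bar>Re z\<bar>" using assms(2) by (intro mult_right_mono) auto
  ultimately show False by simp
qed

text \<open>A term \<open>(c, d, z, x, y)\<close> stands for the elementary tensor \<open>(c + d b\<^sub>t(z)) x \<otimes> y\<close>,
  where \<open>b\<^sub>t(z) = (z - t) / (1 - t z)\<close>.\<close>

type_synonym 'a pencil = "(complex \<times> complex \<times> complex \<times> 'a \<times> 'a) list"

definition pencil_form ::
  "('a \<Rightarrow> 'a \<Rightarrow> complex) \<Rightarrow> real \<Rightarrow> 'a pencil \<Rightarrow> complex" where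
  "pencil_form \<kappa> t ts = (\<Sum>(c, d, z, x, y)\<leftarrow>ts. (c + d * mob t z) * \<kappa> x y)"

text \<open>What integration of \<open>pencil_form\<close> with \<open>dE(t)\<close> in the place of
  \<kappa> should give: \<open>E\<close> has total mass \<open>I\<close>, and b_t(z) integrates to
  \<Omega>(z).\<close>

definition pencil_value ::
  "(complex \<Rightarrow> 'a::complex_hilbert_space \<Rightarrow>\<^sub>L 'a) \<Rightarrow> 'a pencil \<Rightarrow> complex" where
  "pencil_value \<Omega> ts =
    (\<Sum>(c, d, z, x, y)\<leftarrow>ts. c * cinner x y + d * cinner (blinfun_apply (\<Omega> z) x) y)"

text \<open>A pointwise positivity test. Since \<kappa> ranges over all positive forms it can stand
  for any value of an operator measure, so that no such measure has to be constructed.\<close>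

definition pencil_nonneg :: "'a::complex_hilbert_space pencil \<Rightarrow> bool" where
  "pencil_nonneg ts \<longleftrightarrow> (\<forall>(c, d, z, x, y)\<in>set ts. z \<in> slit_plane) \<and>
    (\<forall>\<kappa> t. pos_form \<kappa> \<longrightarrow> \<bar>t\<bar> \<le> 1 \<longrightarrow> 0 \<le> Re (pencil_form \<kappa> t ts))"

lemma pencil_Nil [simp]: "pencil_form \<kappa> t [] = 0" "pencil_value \<Omega> [] = 0"
  by (simp_all add: pencil_form_def pencil_value_def)

lemma pencil_Cons [simp]:
  "pencil_form \<kappa> t ((c, d, z, x, y) # ts) = (c + d * mob t z) * \<kappa> x y + pencil_form \<kappa> t ts"
  "pencil_value \<Omega> ((c, d, z, x, y) # ts) =
    c * cinner x y + d * cinner (blinfun_apply (\<Omega> z) x) y + pencil_value \<Omega> ts"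
  by (simp_all add: pencil_form_def pencil_value_def)

text \<open>Two dilations make \<open>\<Omega>\<close> analytic up to the cuts and keep the singular points \<open>1\<close> and
  \<open>-1\<close> off the support of the representing measure.\<close>

definition dilated ::
  "(complex \<Rightarrow> 'a::complex_hilbert_space \<Rightarrow>\<^sub>L 'a) \<Rightarrow> real \<Rightarrow> complex \<Rightarrow> 'a \<Rightarrow>\<^sub>L 'a" where
  "dilated \<Omega> r z = \<Omega> (zhuk (of_real r * zhuk_inv (of_real r * z)))"

lemma dilated_kernel_integral:
  assumes \<Omega>: "\<Omega> \<in> RS" and r: "0 < r" "r < 1" and z: "of_real r * z \<in> slit_plane"
  shows "((\<lambda>s. circ_form \<Omega> r (circlepath 0 1 s) x y *
      (of_real r * z / (1 - of_real r * z * of_real (Re (circlepath 0 1 s))))) has_integral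
      cinner (blinfun_apply (dilated \<Omega> r z) x) y - cinner (blinfun_apply (\<Omega> 0) x) y) {0..1}"
  using circ_form_integral[OF \<Omega> r zhuk_zhuk_inv(1)[OF z], of x y]
  unfolding zhuk_zhuk_inv(2)[OF z] dilated_def .

section \<open>Integral representation of the dilated functions\<close>

text \<open>Half the difference of the kernels \<open>r * w / (1 - r * w * t)\<close> at
  \<open>w = 1\<close> and \<open>w = -1\<close>. It converts the density for these kernels into a
  density for b_t with \<open>t\<close> scaled by \<open>r\<close>.\<close>

definition weight :: "real \<Rightarrow> real \<Rightarrow> real" where
  "weight r t = r / (1 - r\<^sup>2 * t\<^sup>2)"

lemma abs_mult_less_one:
  assumes "\<bar>r\<bar> < 1" "\<bar>t\<bar> \<le> 1" shows "\<bar>r * t\<bar> < (1::real)"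
proof -
  have "\<bar>r * t\<bar> = \<bar>r\<bar> * \<bar>t\<bar>" by (rule abs_mult)
  also have "\<dots> \<le> \<bar>r\<bar> * 1" using assms by (intro mult_left_mono) auto
  finally show ?thesis using assms by simp
qed

lemma weight_nonneg: "0 < r \<Longrightarrow> r < 1 \<Longrightarrow> \<bar>t\<bar> \<le> 1 \<Longrightarrow> 0 \<le> weight r t"
proof -
  assume "0 < r" "r < 1" "\<bar>t\<bar> \<le> 1"
  then have "\<bar>r * t\<bar> \<le> 1" using abs_mult_less_one[of r t] by simp
  then have "(r * t)\<^sup>2 \<le> 1" by (simp add: abs_square_le_1)
  then show ?thesis using \<open>0 < r\<close> by (simp add: weight_def power_mult_distrib)
qed

text \<open>A partial fraction decomposition in \<open>t\<close>: the right-hand side consists of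
  the kernel \<open>r * w / (1 - r * w * t)\<close> at \<open>w = 1\<close>, -1 and
  \<open>z\<close>, whose integrals \<open>dilated_kernel_integral\<close> supplies.\<close>

lemma weight_mob:
  assumes r: "0 < r" "r < 1" and t: "\<bar>t\<bar> \<le> 1" and z: "z \<in> slit_plane"
  shows "of_real (weight r t) * (c + d * mob (r * t) z) =
     (c - d) / 2 * (of_real r * 1 / (1 - of_real r * 1 * of_real t))
   + (- c - d) / 2 * (of_real r * (-1) / (1 - of_real r * (-1) * of_real t))
   + d * (of_real r * z / (1 - of_real r * z * of_real t))"
proof -
  have rt: "\<bar>r * t\<bar> < 1" using r t by (intro abs_mult_less_one) auto
  define a where "a = complex_of_real r"
  define b where "b = complex_of_real t"
  have 1: "1 - a * b * z \<noteq> 0" using mob_denominator[OF z, of "r * t"] rt by (simp add: a_def b_def)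
  have "complex_of_real (1 - r * t) \<noteq> 0" "complex_of_real (1 + r * t) \<noteq> 0"
    using rt unfolding of_real_eq_0_iff by auto
  then have 2: "1 - a * b \<noteq> 0" and 3: "1 + a * b \<noteq> 0"
    by (simp_all add: a_def b_def)
  have "1 - a\<^sup>2 * b\<^sup>2 = (1 - a * b) * (1 + a * b)" by (simp add: power2_eq_square algebra_simps)
  then have w: "complex_of_real (weight r t) = a / ((1 - a * b) * (1 + a * b))"
    by (simp add: weight_def a_def b_def)
  have half: "a / ((1 - a * b) * (1 + a * b)) = (a / (1 - a * b) + a / (1 + a * b)) / 2"
    using 2 3 by (simp add: divide_simps) (simp add: algebra_simps)
  have m: "a / ((1 - a * b) * (1 + a * b)) * ((z - a * b) / (1 - a * b * z)) =
      a * z / (1 - a * b * z) - (a / (1 - a * b) - a / (1 + a * b)) / 2"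
    using 1 2 3 by (simp add: divide_simps) (simp add: algebra_simps)
  have part: "c * ((P + M) / 2) + d * (Z - (P - M) / 2) = (c - d) / 2 * P + (c + d) / 2 * M + d * Z"
    for P M Z by (simp add: field_simps)
  have "of_real (weight r t) * (c + d * mob (r * t) z) = c * ((a / (1 - a * b) + a / (1 + a * b)) / 2)
      + d * (a / ((1 - a * b) * (1 + a * b)) * ((z - a * b) / (1 - a * b * z)))"
    unfolding w half[symmetric] mob_def by (simp add: a_def b_def algebra_simps)
  also have "\<dots> = (c - d) / 2 * (a / (1 - a * b)) + (c + d) / 2 * (a / (1 + a * b))
      + d * (a * z / (1 - a * b * z))"
    unfolding m by (rule part)
  also have "(c + d) / 2 * (a / (1 + a * b)) = (- c - d) / 2 * (a * (-1) / (1 - a * (-1) * b))"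
    using 3 by (simp add: divide_simps) (simp add: algebra_simps)
  also have "a * z / (1 - a * b * z) = a * z / (1 - a * z * b)" by (simp add: mult_ac)
  finally show ?thesis by (simp add: a_def b_def)
qed

text \<open>The representation of the dilated function, with its atoms moved to the right. They sit
  at 1 and -1 with masses \<open>(I - dilated \<Omega> r 1) / 2\<close> and
  \<open>(I + dilated \<Omega> r (-1)) / 2\<close>, which complete the total mass to
  \<open>I\<close>.\<close>

lemma pencil_integral:
  assumes \<Omega>: "\<Omega> \<in> RS" and r: "0 < r" "r < 1"
    and ts: "\<forall>(c, d, z, x, y)\<in>set ts. z \<in> slit_plane"
  shows "((\<lambda>s. of_real (weight r (Re (circlepath 0 1 s))) *
        pencil_form (circ_form \<Omega> r (circlepath 0 1 s)) (r * Re (circlepath 0 1 s)) ts) has_integral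
      pencil_value (dilated \<Omega> r) ts
      - pencil_form (\<lambda>x y. cinner x y - cinner (blinfun_apply (dilated \<Omega> r 1) x) y) 1 ts / 2
      - pencil_form (\<lambda>x y. cinner x y + cinner (blinfun_apply (dilated \<Omega> r (-1)) x) y) (-1) ts / 2)
      {0..1}"
  using ts
proof (induction ts)
  case (Cons a ts)
  obtain c d z x y where a: "a = (c, d, z, x, y)" by (cases a)
  with Cons.prems have z: "z \<in> slit_plane" by simp
  define v where "v = circlepath 0 1"
  define t where "t s = Re (v s)" for s
  have t: "\<bar>t s\<bar> \<le> 1" for s
    using abs_Re_le_cmod[of "v s"] by (simp add: t_def v_def circlepath)
  have sl: "of_real r * 1 \<in> slit_plane" "of_real r * (-1) \<in> slit_plane" "of_real r * z \<in> slit_plane"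
    using r scaled_in_slit_plane[OF z, of r] by (auto simp: slit_plane_iff)
  define F where "F w = cinner (blinfun_apply (dilated \<Omega> r w) x) y" for w
  define X where "X w s = circ_form \<Omega> r (v s) x y * (of_real r * w / (1 - of_real r * w * of_real (t s)))" for w s
  have X: "(X w has_integral F w - cinner (blinfun_apply (\<Omega> 0) x) y) {0..1}"
    if "of_real r * w \<in> slit_plane" for w
    using dilated_kernel_integral[OF \<Omega> r that, of x y] unfolding X_def t_def v_def F_def .
  \<comment> \<open>The three coefficients add up to 0, so the contributions of
    \<open>\<Omega> 0\<close> cancel.\<close>
  have "((\<lambda>s. (c - d) / 2 * X 1 s + (- c - d) / 2 * X (-1) s + d * X z s) has_integral
      ((c - d) / 2 * (F 1 - cinner (blinfun_apply (\<Omega> 0) x) y) +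
      (- c - d) / 2 * (F (-1) - cinner (blinfun_apply (\<Omega> 0) x) y) +
      d * (F z - cinner (blinfun_apply (\<Omega> 0) x) y))) {0..1}"
    by (intro has_integral_add has_integral_mult_right X sl)
  moreover have "(c - d) / 2 * X 1 s + (- c - d) / 2 * X (-1) s + d * X z s =
      of_real (weight r (t s)) * ((c + d * mob (r * t s) z) * circ_form \<Omega> r (v s) x y)" for s
    unfolding mult.assoc[symmetric] weight_mob[OF r t z] by (simp add: X_def algebra_simps)
  moreover have "(c - d) / 2 * (F 1 - cinner (blinfun_apply (\<Omega> 0) x) y) +
      (- c - d) / 2 * (F (-1) - cinner (blinfun_apply (\<Omega> 0) x) y) +
      d * (F z - cinner (blinfun_apply (\<Omega> 0) x) y) =
      (c * cinner x y + d * F z) - (c + d * mob 1 z) * (cinner x y - F 1) / 2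
      - (c + d * mob (-1) z) * (cinner x y + F (-1)) / 2"
  proof -
    \<comment> \<open>At the ends of \<open>[-1, 1]\<close> the function b_t degenerates to a
      constant, so the atoms only see \<open>c - d\<close> and \<open>c + d\<close>.\<close>
    have "mob 1 z = - 1" "mob (-1) z = 1"
      using mob_denominator[OF z, of 1] mob_denominator[OF z, of "-1"]
      by (simp_all add: mob_def divide_simps)
    then show ?thesis by (simp add: field_simps)
  qed
  ultimately have "((\<lambda>s. of_real (weight r (t s)) * ((c + d * mob (r * t s) z) * circ_form \<Omega> r (v s) x y))
      has_integral (c * cinner x y + d * F z) - (c + d * mob 1 z) * (cinner x y - F 1) / 2
      - (c + d * mob (-1) z) * (cinner x y + F (-1)) / 2) {0..1}"
    by (simp only:)
  from has_integral_add[OF this Cons.IH[folded v_def, folded t_def]] Cons.prems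
  show ?case
    unfolding a v_def[symmetric] t_def[symmetric]
    by (simp add: F_def add_divide_distrib distrib_left add_ac diff_add_eq diff_diff_eq add_diff_eq)
qed simp

lemma zhuk_inv_real: "\<bar>s\<bar> < 1 \<Longrightarrow> \<exists>q. \<bar>q\<bar> < 1 \<and> zhuk_inv (of_real s) = of_real q"
proof -
  assume s: "\<bar>s\<bar> < 1"
  then have "0 \<le> 1 - s\<^sup>2" by (simp add: abs_square_le_1)
  then have "csqrt (1 - (of_real s)\<^sup>2) = of_real (sqrt (1 - s\<^sup>2))"
    using csqrt_of_real_nonneg[of "of_real (1 - s\<^sup>2)"] by simp
  then have *: "zhuk_inv (of_real s) = of_real (s / (1 + sqrt (1 - s\<^sup>2)))"
    by (simp add: zhuk_inv_def)
  moreover have "cmod (zhuk_inv (of_real s)) < 1"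
    by (rule zhuk_zhuk_inv(1)[OF of_real_in_slit_plane[OF s]])
  ultimately show ?thesis by (metis norm_of_real)
qed

text \<open>Even at 1 and -1 the dilated function takes a value of \<Omega> at an interior real
  point, where the bounds by \<open>I\<close> and \<open>- I\<close> hold. This makes the masses of
  the two atoms positive.\<close>

lemma dilated_real:
  assumes "0 < r" "r < 1" "\<bar>s\<bar> \<le> 1"
  shows "\<exists>q. \<bar>q\<bar> < 1 \<and> dilated \<Omega> r (of_real s) = \<Omega> (of_real q)"
proof -
  have less: "\<bar>r * q\<bar> < 1" if "\<bar>q\<bar> \<le> 1" for q
    using assms that by (intro abs_mult_less_one) auto
  obtain q where q: "\<bar>q\<bar> < 1" "zhuk_inv (of_real (r * s)) = of_real q"
    using zhuk_inv_real[OF less[OF assms(3)]] by blast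
  then have "dilated \<Omega> r (of_real s) = \<Omega> (zhuk (of_real (r * q)))"
    by (simp add: dilated_def)
  also note zhuk_of_real
  finally have "dilated \<Omega> r (of_real s) = \<Omega> (of_real (2 * (r * q) / (1 + (r * q)\<^sup>2)))" .
  with zhuk_real_less_one[OF less[of q]] q show ?thesis by (metis less_imp_le)
qed

lemma pos_form_atoms:
  assumes \<Omega>: "\<Omega> \<in> RS" and s: "\<bar>s\<bar> < 1"
  shows "pos_form (\<lambda>x y. cinner x y - cinner (blinfun_apply (\<Omega> (of_real s)) x) y)"
    "pos_form (\<lambda>x y. cinner x y + cinner (blinfun_apply (\<Omega> (of_real s)) x) y)"
proof -
  have sl: "of_real s \<in> slit_plane" by (rule of_real_in_slit_plane[OF s])
  have sym: "cinner (blinfun_apply (\<Omega> (of_real s)) x) y = cinner x (blinfun_apply (\<Omega> (of_real s)) y)" for x y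
    using RS_adjoint[OF \<Omega> sl, of x y] by simp
  have cnj: "cnj (cinner x y) = cinner y x" for x y :: 'a
    by (metis cinner_commute)
  show "pos_form (\<lambda>x y. cinner x y - cinner (blinfun_apply (\<Omega> (of_real s)) x) y)"
    "pos_form (\<lambda>x y. cinner x y + cinner (blinfun_apply (\<Omega> (of_real s)) x) y)"
    using RS_real_bounds[OF \<Omega> s] unfolding pos_form_def sym
    by (auto simp: cinner_simps cnj sym algebra_simps)
qed

lemma RS_pencil_dilated_nonneg:
  assumes \<Omega>: "\<Omega> \<in> RS" and r: "0 < r" "r < 1" and ts: "pencil_nonneg ts"
  shows "0 \<le> Re (pencil_value (dilated \<Omega> r) ts)"
proof -
  let ?p = "pencil_form (\<lambda>x y. cinner x y - cinner (blinfun_apply (dilated \<Omega> r 1) x) y) 1 ts"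
  let ?m = "pencil_form (\<lambda>x y. cinner x y + cinner (blinfun_apply (dilated \<Omega> r (-1)) x) y) (-1) ts"
  let ?I = "pencil_value (dilated \<Omega> r) ts - ?p / 2 - ?m / 2"
  have pos: "0 \<le> Re (pencil_form \<kappa> t ts)" if "pos_form \<kappa>" "\<bar>t\<bar> \<le> 1" for \<kappa> t
    using ts that by (simp add: pencil_nonneg_def)
  have "((\<lambda>s. Re (of_real (weight r (Re (circlepath 0 1 s))) *
      pencil_form (circ_form \<Omega> r (circlepath 0 1 s)) (r * Re (circlepath 0 1 s)) ts))
      has_integral Re ?I) {0..1}"
    using has_integral_linear[OF pencil_integral[OF \<Omega> r] bounded_linear_Re] ts
    by (simp add: pencil_nonneg_def o_def)
  then have "0 \<le> Re ?I"
  proof (rule has_integral_nonneg)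
    fix s
    define v where "v = circlepath 0 1 s"
    have v: "cmod v = 1" by (simp add: v_def circlepath)
    then have t: "\<bar>Re v\<bar> \<le> 1" using abs_Re_le_cmod[of v] by simp
    then have "\<bar>r * Re v\<bar> \<le> 1" using abs_mult_less_one[of r "Re v"] r t by simp
    then show "0 \<le> Re (of_real (weight r (Re (circlepath 0 1 s))) *
      pencil_form (circ_form \<Omega> r (circlepath 0 1 s)) (r * Re (circlepath 0 1 s)) ts)"
      unfolding v_def[symmetric]
      using pos[OF pos_form_circ_form[OF \<Omega> r v]] weight_nonneg[OF r t] by simp
  qed
  moreover have "0 \<le> Re ?p"
    using pos_form_atoms(1)[OF \<Omega>] dilated_real[OF r, of 1 \<Omega>] pos[of _ 1] by fastforce
  moreover have "0 \<le> Re ?m"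
    using pos_form_atoms(2)[OF \<Omega>] dilated_real[OF r, of "-1" \<Omega>] pos[of _ "-1"] by fastforce
  ultimately show ?thesis by simp
qed

section \<open>Removal of the dilations\<close>

lemma dilated_tendsto:
  assumes \<Omega>: "\<Omega> \<in> RS" and z: "z \<in> slit_plane" and r: "r \<longlonglongrightarrow> 1"
  shows "(\<lambda>n. dilated \<Omega> (r n) z) \<longlonglongrightarrow> \<Omega> z"
proof -
  have r': "(\<lambda>n. complex_of_real (r n)) \<longlonglongrightarrow> 1" using tendsto_of_real[OF r] by simp
  have "(\<lambda>n. of_real (r n) * z) \<longlonglongrightarrow> 1 * z" by (intro tendsto_intros r')
  then have "(\<lambda>n. zhuk_inv (of_real (r n) * z)) \<longlonglongrightarrow> zhuk_inv z"
    using isCont_tendsto_compose[OF isCont_zhuk_inv[OF z]] by simp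
  then have "(\<lambda>n. of_real (r n) * zhuk_inv (of_real (r n) * z)) \<longlonglongrightarrow> 1 * zhuk_inv z"
    by (intro tendsto_intros r')
  then have "(\<lambda>n. zhuk (of_real (r n) * zhuk_inv (of_real (r n) * z))) \<longlonglongrightarrow> z"
    using isCont_tendsto_compose[OF isCont_zhuk[OF zhuk_zhuk_inv(1)[OF z]]] zhuk_zhuk_inv(2)[OF z] by simp
  then show ?thesis
    unfolding dilated_def by (rule isCont_tendsto_compose[OF RS_isCont[OF \<Omega> z]])
qed

text \<open>Stands in for the integral representation: an inequality between the functions b_t,
  valid for every positive form, is inherited by \<Omega>. Both directions of the theorem use
  \<Omega> through such inequalities.\<close>

lemma RS_pencil_nonneg:
  assumes \<Omega>: "\<Omega> \<in> RS" and ts: "pencil_nonneg ts"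
  shows "0 \<le> Re (pencil_value \<Omega> ts)"
proof -
  \<comment> \<open>The second \<open>Suc\<close> makes \<open>r 0 = 1 / 2\<close>, so that every
    \<open>r n\<close> is strictly positive.\<close>
  define r where "r n = 1 - inverse (real (Suc (Suc n)))" for n
  have "(\<lambda>n. inverse (real (Suc (Suc n)))) \<longlonglongrightarrow> 0"
    using LIMSEQ_Suc[OF LIMSEQ_inverse_real_of_nat] .
  then have "r \<longlonglongrightarrow> 1 - 0" unfolding r_def by (intro tendsto_intros)
  then have lim: "r \<longlonglongrightarrow> 1" by simp
  have "(\<lambda>n. pencil_value (dilated \<Omega> (r n)) us) \<longlonglongrightarrow> pencil_value \<Omega> us"
    if "\<forall>(c, d, z, x, y)\<in>set us. z \<in> slit_plane" for us
    using that
  proof (induction us)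
    case (Cons a us)
    obtain c d z x y where a: "a = (c, d, z, x, y)" by (cases a)
    with Cons.prems have z: "z \<in> slit_plane" by simp
    have "(\<lambda>n. cinner (blinfun_apply (dilated \<Omega> (r n) z) x) y) \<longlonglongrightarrow> cinner (blinfun_apply (\<Omega> z) x) y"
      by (rule bounded_linear.tendsto[OF bounded_linear_cinner_blinfun_left dilated_tendsto[OF \<Omega> z lim]])
    with Cons show ?case unfolding a by (auto intro!: tendsto_intros)
  qed simp
  with ts have "(\<lambda>n. Re (pencil_value (dilated \<Omega> (r n)) ts)) \<longlonglongrightarrow> Re (pencil_value \<Omega> ts)"
    by (auto simp: pencil_nonneg_def intro: tendsto_Re)
  moreover have "0 \<le> Re (pencil_value (dilated \<Omega> (r n)) ts)" for n
  proof (rule RS_pencil_dilated_nonneg[OF \<Omega> _ _ ts])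
    show "0 < r n" "r n < 1" by (simp_all add: r_def field_simps)
  qed
  ultimately show ?thesis by (intro LIMSEQ_le_const) auto
qed

subsection \<open>Inner functions\<close>

text \<open>The subtraction formula of the hyperbolic tangent, since \<open>b\<^sub>t(z) = tanh (\<zeta> - \<tau>)\<close> for
  \<open>z = tanh \<zeta>\<close> and \<open>t = tanh \<tau>\<close>.\<close>

lemma mob_product:
  assumes "z \<in> slit_plane" "w \<in> slit_plane" "\<bar>t\<bar> \<le> 1" "z \<noteq> w"
  shows "mob t z * mob t w = 1 - (1 - z * w) / (z - w) * (mob t z - mob t w)"
proof -
  define b where "b = complex_of_real t"
  have nz: "1 - b * z \<noteq> 0" "1 - b * w \<noteq> 0" "z - w \<noteq> 0"
    using mob_denominator[OF assms(1,3)] mob_denominator[OF assms(2,3)] assms(4) by (auto simp: b_def)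
  have "mob t z - mob t w = (z - w) * (1 - b\<^sup>2) / ((1 - b * z) * (1 - b * w))"
    using nz by (simp add: mob_def flip: b_def) (simp add: divide_simps, simp add: power2_eq_square algebra_simps)
  then have "(1 - z * w) / (z - w) * (mob t z - mob t w)
      = (1 - z * w) * (1 - b\<^sup>2) / ((1 - b * z) * (1 - b * w))"
    using nz by simp
  also have "1 - \<dots> = (z - b) * (w - b) / ((1 - b * z) * (1 - b * w))"
    using nz by (simp add: divide_simps) (simp add: power2_eq_square algebra_simps)
  also have "\<dots> = mob t z * mob t w" by (simp add: mob_def flip: b_def)
  finally show ?thesis ..
qed

lemma cnj_mob: "cnj (mob t z) = mob t (cnj z)"
  by (simp add: mob_def)

text \<open>The product formula at \<open>w = cnj z\<close>, where \<open>1 - z * w = 0\<close>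
  removes the second term. Points of the circle in the slit plane are nonreal, so \<open>z\<close>
  and \<open>cnj z\<close> differ.\<close>

lemma mob_unimodular:
  assumes "cmod z = 1" "z \<in> slit_plane" "\<bar>t\<bar> \<le> 1"
  shows "mob t z * cnj (mob t z) = 1"
proof -
  have "Im z \<noteq> 0"
  proof
    assume "Im z = 0"
    then have "\<bar>Re z\<bar> = 1" using assms(1) by (simp add: cmod_def)
    with \<open>Im z = 0\<close> assms(2) show False by (simp add: slit_plane_iff)
  qed
  then have "z \<noteq> cnj z" by (simp add: complex_eq_iff)
  moreover have "z * cnj z = 1" using complex_norm_square[of z] assms(1) by simp
  ultimately show ?thesis
    using mob_product[OF assms(2) cnj_in_slit_plane[OF assms(2)] assms(3)] by (simp add: cnj_mob)
qed

text \<open>\<open>mob_product\<close> transferred to \<Omega>, with denominators cleared so that it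
  can be continued analytically. With b and c the values of b_t at \<open>z\<close> and
  \<open>cnj w\<close>, positivity is applied to the square of \<open>Y + c X + b u\<close>, where
  \<open>X = s x\<close> and \<open>Y = - s \<Omega>(cnj w) x\<close>. Isometry at
  \<open>cnj w\<close> makes the terms quadratic in \<open>s\<close> cancel, and a real affine
  function of \<open>s\<close> that is bounded below is constant.\<close>

lemma RS_circle_identity:
  fixes \<Omega> :: "complex \<Rightarrow> 'a::complex_hilbert_space \<Rightarrow>\<^sub>L 'a"
  assumes \<Omega>: "\<Omega> \<in> RS" and z: "cmod z = 1" "z \<in> slit_plane" and w: "cmod w = 1" "w \<in> slit_plane"
    and iso: "op_isometric (\<Omega> (cnj w))"
  shows "(1 - z * w) * cinner (blinfun_apply (\<Omega> z) u - blinfun_apply (\<Omega> w) u) x =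
    (z - w) * cinner (u - blinfun_apply (\<Omega> w) (blinfun_apply (\<Omega> z) u)) x"
proof (cases "z = w")
  case False
  define k where "k = (1 - z * w) / (z - w)"
  define U where "U = blinfun_apply (\<Omega> (cnj w))"
  define E where "E u = cinner u x - k * cinner (blinfun_apply (\<Omega> z) u - blinfun_apply (\<Omega> w) u) x
    - cinner (blinfun_apply (\<Omega> z) u) (U x)" for u
  have cw: "cnj w \<in> slit_plane" by (rule cnj_in_slit_plane[OF w(2)])
  \<comment> \<open>Half the coefficient of \<open>s\<close> is the real part of \<open>E u\<close>,
    the defect in multiplicativity tested against \<open>x\<close>.\<close>
  have pos: "0 \<le> Re (cinner u u) + 2 * s * Re (E u)" for u s
  proof -
    define X where "X = s *\<^sub>R x"
    define Y where "Y = - (s *\<^sub>R U x)"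
    \<comment> \<open>The expanded square: unimodularity turns its diagonal coefficients into 1,
      hermitian symmetry merges conjugate cross terms, and \<open>mob_product\<close> makes the
      product in the \<open>u\<close>, \<open>X\<close> term affine in single values of b_t.\<close>
    define ts :: "'a pencil" where "ts = [(1, 0, 0, Y, Y), (1, 0, 0, X, X), (1, 0, 0, u, u), (0, 2, cnj w, X, Y),
      (0, 2, z, u, Y), (2, - 2 * k, z, u, X), (0, 2 * k, w, u, X)]"
    have "0 \<le> Re (pencil_form \<kappa> t ts)" if \<kappa>: "pos_form \<kappa>" and t: "\<bar>t\<bar> \<le> 1" for \<kappa> t
    proof -
      define b where "b = mob t z"
      define c where "c = mob t (cnj w)"
      have uni: "b * cnj b = 1" "c * cnj c = 1"
        using mob_unimodular[OF z t] mob_unimodular[OF _ cw t] w by (simp_all add: b_def c_def)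
      have prod: "b * cnj c = 1 - k * (b - cnj c)"
        using mob_product[OF z(2) w(2) t False] by (simp add: b_def c_def k_def cnj_mob)
      note \<kappa>D = pos_formD[OF \<kappa>]
      have herm: "Re (a * \<kappa> p q) = Re (cnj a * \<kappa> q p)" for a p q
        using \<kappa>D(5)[of p q] by simp
      have "0 \<le> Re (\<kappa> (Y + c *\<^sub>C X + b *\<^sub>C u) (Y + c *\<^sub>C X + b *\<^sub>C u))"
        by (rule \<kappa>D(6))
      also have "\<kappa> (Y + c *\<^sub>C X + b *\<^sub>C u) (Y + c *\<^sub>C X + b *\<^sub>C u) =
          \<kappa> Y Y + (c * cnj c) * \<kappa> X X + (b * cnj b) * \<kappa> u u
          + (c * \<kappa> X Y + cnj c * \<kappa> Y X) + (b * \<kappa> u Y + cnj b * \<kappa> Y u)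
          + ((b * cnj c) * \<kappa> u X + cnj (b * cnj c) * \<kappa> X u)"
        by (simp add: \<kappa>D(1-4) algebra_simps)
      also have "Re \<dots> = Re (\<kappa> Y Y + \<kappa> X X + \<kappa> u u + 2 * (c * \<kappa> X Y) + 2 * (b * \<kappa> u Y)
          + 2 * ((b * cnj c) * \<kappa> u X))"
        unfolding uni using herm[of c X Y] herm[of b u Y] herm[of "b * cnj c" u X] by simp
      also have "\<dots> = Re (pencil_form \<kappa> t ts)"
        unfolding prod by (simp add: ts_def b_def c_def cnj_mob algebra_simps)
      finally show ?thesis .
    qed
    moreover have "\<forall>(c, d, z, x, y)\<in>set ts. z \<in> slit_plane"
      using z w cw zero_in_slit_plane by (simp add: ts_def)
    ultimately have nn: "0 \<le> Re (pencil_value \<Omega> ts)"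
      by (intro RS_pencil_nonneg[OF \<Omega>]) (simp add: pencil_nonneg_def)
    have "cinner (U x) (U x) = cinner x x"
      using iso unfolding cinner_self by (simp add: U_def op_isometric_def)
    moreover have "U (s *\<^sub>R x) = s *\<^sub>R U x" by (simp add: U_def blinfun.scaleR_right)
    ultimately have "pencil_value \<Omega> ts = cinner u u + 2 * of_real s * E u"
      by (simp add: ts_def E_def X_def Y_def U_def[symmetric] cinner_simps blinfun.scaleR_right
          algebra_simps)
    then show ?thesis using nn by simp
  qed
  have Re0: "Re (E u) = 0" for u
  proof (rule ccontr)
    assume *: "Re (E u) \<noteq> 0"
    have "2 * (- (Re (cinner u u) + 1) / (2 * Re (E u))) * Re (E u) = - (Re (cinner u u) + 1)"
      using * by simp
    then show False using pos[of u "- (Re (cinner u u) + 1) / (2 * Re (E u))"] by linarith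
  qed
  \<comment> \<open>\<open>E\<close> is complex linear in \<open>u\<close>, so the vanishing of its
    real part at \<open>\<i> *\<^sub>C u\<close> removes the imaginary part at
    \<open>u\<close>.\<close>
  have "E (\<i> *\<^sub>C u) = \<i> * E u" for u
    by (simp add: E_def RS_complex_linear[OF \<Omega>] z w cinner_simps algebra_simps)
  then have "E u = 0" for u
    using Re0[of u] Re0[of "\<i> *\<^sub>C u"] by (simp add: complex_eq_iff)
  moreover have "cinner (blinfun_apply (\<Omega> z) u) (U x) = cinner (blinfun_apply (\<Omega> w) (blinfun_apply (\<Omega> z) u)) x"
    using RS_adjoint[OF \<Omega> w(2)] by (simp add: U_def)
  ultimately have "cinner (u - blinfun_apply (\<Omega> w) (blinfun_apply (\<Omega> z) u)) x =
      k * cinner (blinfun_apply (\<Omega> z) u - blinfun_apply (\<Omega> w) u) x"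
    by (simp add: E_def cinner_diff_left algebra_simps)
  then show ?thesis using False by (simp add: k_def)
qed simp

section \<open>Analytic continuation off the circle\<close>

lemma RS_holomorphic_eq:
  assumes "f holomorphic_on slit_plane" "g holomorphic_on slit_plane"
    "U \<subseteq> slit_plane" "\<xi> \<in> slit_plane" "\<xi> islimpt U" "\<And>z. z \<in> U \<Longrightarrow> f z = g z" "z \<in> slit_plane"
  shows "f z = g z"
  using analytic_continuation[of "\<lambda>z. f z - g z" slit_plane U \<xi> z] assms
    open_slit_plane connected_slit_plane by (auto intro: holomorphic_on_diff)

text \<open>Two successive continuations from the circle: first in \<open>w\<close> with
  \<open>z\<close> fixed on the circle, then in \<open>z\<close> with \<open>w\<close> arbitrary.
  Both start from points accumulating at \<i>.\<close>

lemma RS_global_identity: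
  assumes \<Omega>: "\<Omega> \<in> RS" and U: "\<i> islimpt {w \<in> slit_plane. cmod w = 1 \<and> op_isometric (\<Omega> (cnj w))}"
    and z: "z \<in> slit_plane" and w: "w \<in> slit_plane"
  shows "(1 - z * w) *\<^sub>C (blinfun_apply (\<Omega> z) u - blinfun_apply (\<Omega> w) u) =
    (z - w) *\<^sub>C (u - blinfun_apply (\<Omega> w) (blinfun_apply (\<Omega> z) u))"
proof (rule cinner_ext)
  fix x
  let ?U = "{w \<in> slit_plane. cmod w = 1 \<and> op_isometric (\<Omega> (cnj w))}"
  have i: "\<i> \<in> slit_plane" by (simp add: slit_plane_iff)
  have *: "(1 - z * w) * cinner (blinfun_apply (\<Omega> z) u - blinfun_apply (\<Omega> w) u) x =
    (z - w) * cinner (u - blinfun_apply (\<Omega> w) (blinfun_apply (\<Omega> z) u)) x"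
    if "z \<in> slit_plane" "cmod z = 1" "w \<in> slit_plane" for z w
    using that(3)
  proof (rule RS_holomorphic_eq[where U = ?U and \<xi> = \<i>, rotated -1])
    show "(\<lambda>w. (1 - z * w) * cinner (blinfun_apply (\<Omega> z) u - blinfun_apply (\<Omega> w) u) x) holomorphic_on slit_plane"
      "(\<lambda>w. (z - w) * cinner (u - blinfun_apply (\<Omega> w) (blinfun_apply (\<Omega> z) u)) x) holomorphic_on slit_plane"
      unfolding cinner_diff_left by (intro holomorphic_intros RS_cinner_holomorphic[OF \<Omega>])+
  qed (use that i U RS_circle_identity[OF \<Omega>] in auto)
  \<comment> \<open>Moving \<open>\<Omega> w\<close> to the other side leaves a matrix element of
    \<open>\<Omega> z\<close> between fixed vectors, which is holomorphic in
    \<open>z\<close>.\<close>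
  have adj: "cinner (blinfun_apply (\<Omega> w) (blinfun_apply (\<Omega> z) u)) x =
      cinner (blinfun_apply (\<Omega> z) u) (blinfun_apply (\<Omega> (cnj w)) x)" for z
    by (rule RS_adjoint[OF \<Omega> w])
  have "(1 - z * w) * cinner (blinfun_apply (\<Omega> z) u - blinfun_apply (\<Omega> w) u) x =
    (z - w) * cinner (u - blinfun_apply (\<Omega> w) (blinfun_apply (\<Omega> z) u)) x"
    using z
  proof (rule RS_holomorphic_eq[where U = ?U and \<xi> = \<i>, rotated -1])
    show "(\<lambda>z. (1 - z * w) * cinner (blinfun_apply (\<Omega> z) u - blinfun_apply (\<Omega> w) u) x) holomorphic_on slit_plane"
      "(\<lambda>z. (z - w) * cinner (u - blinfun_apply (\<Omega> w) (blinfun_apply (\<Omega> z) u)) x) holomorphic_on slit_plane"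
      unfolding cinner_diff_left adj by (intro holomorphic_intros RS_cinner_holomorphic[OF \<Omega>])+
  qed (use * w i U in auto)
  then show "cinner ((1 - z * w) *\<^sub>C (blinfun_apply (\<Omega> z) u - blinfun_apply (\<Omega> w) u)) x =
    cinner ((z - w) *\<^sub>C (u - blinfun_apply (\<Omega> w) (blinfun_apply (\<Omega> z) u))) x"
    by (simp only: cinner_scaleC_left)
qed

lemma AE_lebesgue_on_ex:
  assumes "AE t in lebesgue_on {a..b}. P t" "a \<le> c" "c < d" "d \<le> (b::real)"
  shows "\<exists>t\<in>{c<..<d}. P t"
proof (rule ccontr)
  assume "\<not> ?thesis"
  then have none: "\<not> P t" if "t \<in> {c<..<d}" for t using that by blast
  have "AE t in lebesgue. t \<in> {a..b} \<longrightarrow> P t"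
    using assms(1) by (subst (asm) AE_restrict_space_iff) auto
  then have "AE t in lebesgue. t \<notin> {c<..<d}"
    using assms(2-4) none by (elim eventually_mono) auto
  then have "{c<..<d} \<in> null_sets lebesgue"
    by (subst AE_iff_null_sets) auto
  then have "emeasure lebesgue {c<..<d} = 0" by auto
  with assms(3) show False by simp
qed

text \<open>Isometry holds almost everywhere, hence at points \<open>cis t\<close> arbitrarily close
  to -\<i>; their conjugates \<open>cis (- t)\<close> approach \<i>.\<close>

lemma inner_RS_islimpt:
  assumes "inner_RS \<Omega>"
  shows "\<i> islimpt {w \<in> slit_plane. cmod w = 1 \<and> op_isometric (\<Omega> (cnj w))}"
  unfolding islimpt_approachable
proof (intro allI impI)
  fix e :: real assume "0 < e"
  have "isCont (\<lambda>t. cis (- t)) (3 * pi / 2)"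
    unfolding cis_conv_exp by (intro continuous_intros)
  then obtain d where d: "d > 0"
    "\<And>t. dist t (3 * pi / 2) < d \<Longrightarrow> dist (cis (- t)) (cis (- (3 * pi / 2))) < e"
    using \<open>0 < e\<close> unfolding continuous_at_eps_delta by blast
  \<comment> \<open>The bound 1 is less than \<open>pi / 2\<close>: the interval to the right of
    \<open>3 * pi / 2\<close> stays within \<open>2 * pi\<close>, and \<open>cis (- t)\<close> stays
    in the open first quadrant, away from \<i> itself.\<close>
  define h where "h = min d 1"
  have h: "0 < h" "h \<le> d" "h \<le> 1" using d by (auto simp: h_def)
  have ae: "AE t in lebesgue_on {0..2 * pi}. op_isometric (\<Omega> (cis t))"
    using assms by (simp add: inner_RS_def)
  obtain t where t: "3 * pi / 2 < t" "t < 3 * pi / 2 + h" "op_isometric (\<Omega> (cis t))"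
    using AE_lebesgue_on_ex[OF ae, of "3 * pi / 2" "3 * pi / 2 + h"] h pi_gt3 by auto
  define s where "s = t - 3 * pi / 2"
  have s: "0 < s" "s < 1" using t h by (auto simp: s_def)
  have t_s: "t = s - pi / 2 + 2 * pi" by (simp add: s_def)
  have "cos t = sin s" "sin t = - cos s"
    unfolding t_s cos_periodic sin_periodic cos_diff sin_diff by simp_all
  moreover have "0 < sin s" "0 < cos s"
    using s pi_gt3 by (auto intro: sin_gt_zero cos_gt_zero)
  ultimately have "Re (cis (- t)) > 0" "Im (cis (- t)) > 0" by auto
  moreover from this have "cis (- t) \<noteq> \<i>" by (metis less_irrefl imaginary_unit.simps(1))
  moreover have "dist (cis (- t)) \<i> < e"
  proof -
    have "- (3 * pi / 2) = pi / 2 - 2 * pi" by simp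
    then have "cis (- (3 * pi / 2)) = \<i>" by (simp only: cis_divide[symmetric]) simp
    moreover have "dist t (3 * pi / 2) < d" using t h by (auto simp: dist_real_def)
    ultimately show ?thesis using d(2)[of t] by (simp only:)
  qed
  ultimately show "\<exists>w\<in>{w \<in> slit_plane. cmod w = 1 \<and> op_isometric (\<Omega> (cnj w))}. w \<noteq> \<i> \<and> dist w \<i> < e"
    using t by (intro bexI[of _ "cis (- t)"]) (auto simp: slit_plane_iff cis_cnj)
qed

lemma scaleC_cancel:
  assumes "c \<noteq> 0" "c *\<^sub>C x = (of_real a * c) *\<^sub>C y"
  shows "x = a *\<^sub>R y"
proof -
  have "inverse c *\<^sub>C (c *\<^sub>C x) = inverse c *\<^sub>C ((of_real a * c) *\<^sub>C y)"
    using assms(2) by simp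
  moreover have "inverse c * (of_real a * c) = of_real a" using assms(1) by simp
  ultimately show ?thesis using assms(1) by (simp only: scaleC_scaleC) (simp add: scaleC_of_real)
qed

section \<open>From multiplicativity to the functional equation\<close>

lemma blinfun_compose_assoc: "(R o\<^sub>L S) o\<^sub>L T = R o\<^sub>L (S o\<^sub>L T)"
  by (rule blinfun_eqI) simp

lemma blinfun_compose_id: "id_blinfun o\<^sub>L T = T" "T o\<^sub>L id_blinfun = T"
  by (rule blinfun_eqI, simp)+

lemma op_inverse_eqI:
  assumes "S o\<^sub>L T = id_blinfun" "T o\<^sub>L S = id_blinfun"
  shows "op_inverse T = S"
  unfolding op_inverse_def
proof (rule the_equality)
  fix R assume "R o\<^sub>L T = id_blinfun \<and> T o\<^sub>L R = id_blinfun"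
  then have "R o\<^sub>L (T o\<^sub>L S) = S"
    by (simp add: blinfun_compose_id flip: blinfun_compose_assoc)
  then show "R = S" using assms by (simp add: blinfun_compose_id)
qed (use assms in auto)

lemma mobius_in_slit_plane:
  assumes z: "z \<in> slit_plane" and a: "\<bar>a\<bar> < 1"
  shows "1 + of_real a * z \<noteq> 0" "(z + of_real a) / (1 + of_real a * z) \<in> slit_plane"
proof -
  show nz: "1 + of_real a * z \<noteq> 0" using mob_denominator[OF z, of "- a"] a by simp
  show "(z + of_real a) / (1 + of_real a * z) \<in> slit_plane"
  proof (cases "Im z = 0")
    case True
    then have "z = of_real (Re z)" by (simp add: complex_eq_iff)
    then obtain x where x: "z = of_real x" by blast
    have "\<bar>x\<bar> < 1" using z x by (simp add: slit_plane_iff)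
    then have "0 < (1 - x) * (1 - a)" "0 < (1 + x) * (1 + a)"
      using a by (auto intro: mult_pos_pos)
    then have "\<bar>x + a\<bar> < \<bar>1 + a * x\<bar>" by (auto simp: algebra_simps)
    then have "\<bar>(x + a) / (1 + a * x)\<bar> < 1" by (simp add: abs_divide divide_simps split: if_splits)
    from of_real_in_slit_plane[OF this] show ?thesis by (simp add: x)
  next
    case False
    have "Im ((z + of_real a) / (1 + of_real a * z)) =
        Im ((z + of_real a) * cnj (1 + of_real a * z)) / (cmod (1 + of_real a * z))\<^sup>2"
      by (simp add: complex_div_cnj[of "z + of_real a"] flip: of_real_power)
    also have "Im ((z + of_real a) * cnj (1 + of_real a * z)) = Im z * (1 - a\<^sup>2)"
      by (simp add: power2_eq_square algebra_simps)
    finally show ?thesis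
      using False a nz abs_square_less_1[of a] by (auto simp: slit_plane_iff)
  qed
qed

text \<open>For this \<open>w\<close> the global identity becomes
  \<open>\<Omega> w - \<Omega> z = a (I - \<Omega> z \<Omega> w)\<close>, and likewise with the
  product in the other order. Hence \<open>I + a \<Omega> z\<close> and
  \<open>I - a \<Omega> w\<close> multiply to \<open>(1 - a\<^sup>2) I\<close> in both orders, which
  exhibits the inverse.\<close>

lemma inner_RS_functional_equation:
  assumes inner: "inner_RS \<Omega>" and a: "\<bar>a\<bar> < 1" and z: "z \<in> slit_plane"
  defines "w \<equiv> (z + of_real a) / (1 + of_real a * z)"
  shows "op_invertible (id_blinfun - a *\<^sub>R \<Omega> w)"
    "\<Omega> z = (\<Omega> w - a *\<^sub>R id_blinfun) o\<^sub>L op_inverse (id_blinfun - a *\<^sub>R \<Omega> w)"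
proof -
  have \<Omega>: "\<Omega> \<in> RS" using inner by (simp add: inner_RS_def)
  have w: "w \<in> slit_plane" and nz: "1 + of_real a * z \<noteq> 0"
    using mobius_in_slit_plane[OF z a] by (simp_all add: w_def)
  \<comment> \<open>The common factor of \<open>1 - z * w = c\<close> and
    \<open>w - z = a * c\<close>; it is nonzero on the slit plane and can be cancelled.\<close>
  define c where "c = (1 - z\<^sup>2) / (1 + of_real a * z)"
  have "1 - z\<^sup>2 \<noteq> 0" using one_minus_square_slit[OF z] by force
  then have c: "c \<noteq> 0" using nz by (simp add: c_def)
  have "1 - z * w = c" "w - z = of_real a * c"
    using nz by (simp_all add: w_def c_def field_simps power2_eq_square)
  note c_eq = this
  have eq1: "\<Omega> w u - \<Omega> z u = a *\<^sub>R (u - \<Omega> z (\<Omega> w u))" for u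
  proof -
    have "c *\<^sub>C (\<Omega> w u - \<Omega> z u) = (of_real a * c) *\<^sub>C (u - \<Omega> z (\<Omega> w u))"
      using RS_global_identity[OF \<Omega> inner_RS_islimpt[OF inner] w z, of u] c_eq by (simp add: mult.commute)
    then show ?thesis by (rule scaleC_cancel[OF c])
  qed
  have eq2: "\<Omega> w u - \<Omega> z u = a *\<^sub>R (u - \<Omega> w (\<Omega> z u))" for u
  proof -
    have "z - w = of_real (- a) * c" using c_eq(2) by (simp add: algebra_simps)
    then have "c *\<^sub>C (\<Omega> z u - \<Omega> w u) = (of_real (- a) * c) *\<^sub>C (u - \<Omega> w (\<Omega> z u))"
      using RS_global_identity[OF \<Omega> inner_RS_islimpt[OF inner] z w, of u] c_eq(1) by (simp only:)
    then have "\<Omega> z u - \<Omega> w u = (- a) *\<^sub>R (u - \<Omega> w (\<Omega> z u))"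
      by (rule scaleC_cancel[OF c])
    then show ?thesis by (metis minus_diff_eq minus_minus scaleR_minus_left)
  qed
  define T where "T = id_blinfun - a *\<^sub>R \<Omega> w"
  define S where "S = (1 / (1 - a\<^sup>2)) *\<^sub>R (id_blinfun + a *\<^sub>R \<Omega> z)"
  have a2: "1 - a\<^sup>2 \<noteq> 0" using a abs_square_less_1[of a] by simp
  have "(id_blinfun + a *\<^sub>R \<Omega> z) (T u) = (1 - a\<^sup>2) *\<^sub>R u" for u
  proof -
    have "(id_blinfun + a *\<^sub>R \<Omega> z) (T u) = u - a *\<^sub>R (\<Omega> w u - \<Omega> z u) - (a * a) *\<^sub>R \<Omega> z (\<Omega> w u)"
      by (simp add: T_def blinfun.diff_left blinfun.add_left blinfun.scaleR_left blinfun.diff_right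
          blinfun.scaleR_right algebra_simps)
    then show ?thesis unfolding eq1 by (simp add: power2_eq_square algebra_simps)
  qed
  then have ST: "S o\<^sub>L T = id_blinfun"
    using a2 by (intro blinfun_eqI) (simp add: S_def blinfun.scaleR_left)
  have "T ((id_blinfun + a *\<^sub>R \<Omega> z) u) = (1 - a\<^sup>2) *\<^sub>R u" for u
  proof -
    have "T ((id_blinfun + a *\<^sub>R \<Omega> z) u) = u - a *\<^sub>R (\<Omega> w u - \<Omega> z u) - (a * a) *\<^sub>R \<Omega> w (\<Omega> z u)"
      by (simp add: T_def blinfun.diff_left blinfun.add_left blinfun.scaleR_left blinfun.add_right
          blinfun.scaleR_right algebra_simps)
    then show ?thesis unfolding eq2 by (simp add: power2_eq_square algebra_simps)
  qed
  then have TS: "T o\<^sub>L S = id_blinfun"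
    using a2 by (intro blinfun_eqI) (simp add: S_def blinfun.scaleR_left blinfun.scaleR_right)
  show "op_invertible (id_blinfun - a *\<^sub>R \<Omega> w)"
    using ST TS unfolding op_invertible_def T_def by blast
  have "\<Omega> z o\<^sub>L T = \<Omega> w - a *\<^sub>R id_blinfun"
  proof (rule blinfun_eqI)
    fix u
    show "(\<Omega> z o\<^sub>L T) u = (\<Omega> w - a *\<^sub>R id_blinfun) u"
      using eq1[of u] by (simp add: T_def blinfun.diff_left blinfun.scaleR_left blinfun.diff_right
          blinfun.scaleR_right algebra_simps)
  qed
  then have "(\<Omega> z o\<^sub>L T) o\<^sub>L S = (\<Omega> w - a *\<^sub>R id_blinfun) o\<^sub>L S" by simp
  then have "\<Omega> z = (\<Omega> w - a *\<^sub>R id_blinfun) o\<^sub>L S"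
    by (simp add: blinfun_compose_assoc TS blinfun_compose_id)
  then show "\<Omega> z = (\<Omega> w - a *\<^sub>R id_blinfun) o\<^sub>L op_inverse (id_blinfun - a *\<^sub>R \<Omega> w)"
    using op_inverse_eqI[OF ST TS] by (simp add: T_def)
qed

subsection \<open>Solutions of the functional equation\<close>

text \<open>This is \<open>p\<close> times the value of \<kappa> at \<open>u / p - v\<close>, the
  quadratic inequality from which Jensen's inequality is obtained by integration.\<close>

lemma pos_form_weighted_square:
  assumes \<kappa>: "pos_form \<kappa>" and p: "0 < (p::real)"
  shows "0 \<le> Re (of_real (inverse p) * \<kappa> u u - 2 * \<kappa> u v + of_real p * \<kappa> v v)"
proof -
  note \<kappa>D = pos_formD[OF \<kappa>]
  define q where "q = inverse p"
  have pq: "p * q = 1" using p by (simp add: q_def)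
  define x where "x = of_real q *\<^sub>C u + (-1) *\<^sub>C v"
  have "\<kappa> x x = of_real (q * q) * \<kappa> u u - of_real q * (\<kappa> u v + \<kappa> v u) + \<kappa> v v"
    by (simp add: x_def \<kappa>D(1-4) algebra_simps)
  then have "Re (\<kappa> x x) = q * q * Re (\<kappa> u u) - q * (Re (\<kappa> u v) + Re (\<kappa> v u)) + Re (\<kappa> v v)"
    by simp
  then have "p * Re (\<kappa> x x) = p * (q * q * Re (\<kappa> u u) - q * (Re (\<kappa> u v) + Re (\<kappa> v u)) + Re (\<kappa> v v))"
    by (rule arg_cong)
  also have "\<dots> = (p * q) * q * Re (\<kappa> u u) - (p * q) * (Re (\<kappa> u v) + Re (\<kappa> v u)) + p * Re (\<kappa> v v)"
    by (simp only: distrib_left right_diff_distrib mult.assoc)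
  finally have "p * Re (\<kappa> x x) = inverse p * Re (\<kappa> u u) - (Re (\<kappa> u v) + Re (\<kappa> v u)) + p * Re (\<kappa> v v)"
    unfolding pq by (simp add: q_def)
  moreover have "Re (\<kappa> v u) = Re (\<kappa> u v)" by (subst \<kappa>D(5)) simp
  moreover have "0 \<le> p * Re (\<kappa> x x)" using p \<kappa>D(6) by simp
  moreover have "Re (of_real (inverse p) * \<kappa> u u - 2 * \<kappa> u v + of_real p * \<kappa> v v)
      = inverse p * Re (\<kappa> u u) - 2 * Re (\<kappa> u v) + p * Re (\<kappa> v v)"
    by (simp only: minus_complex.simps plus_complex.simps Re_complex_of_real times_complex.simps
        Im_complex_of_real complex_Re_numeral complex_Im_numeral mult_zero_left diff_zero)
  ultimately show ?thesis by linarith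
qed

lemma pos_form_zero:
  assumes \<kappa>: "pos_form \<kappa>" and zero: "\<And>x. Re (\<kappa> x x) = 0"
  shows "\<kappa> x y = 0"
proof -
  note \<kappa>D = pos_formD[OF \<kappa>]
  have re: "Re (\<kappa> x y) = 0" for x y
  proof -
    have "Re (\<kappa> (x + y) (x + y)) = Re (\<kappa> x x) + Re (\<kappa> y y) + Re (\<kappa> x y) + Re (\<kappa> y x)"
      by (simp add: \<kappa>D(1,2))
    moreover have "Re (\<kappa> y x) = Re (\<kappa> x y)" by (subst \<kappa>D(5)) simp
    ultimately show ?thesis by (simp add: zero)
  qed
  have "Im (\<kappa> x y) = Re (\<kappa> x (\<i> *\<^sub>C y))" by (simp add: \<kappa>D(4))
  then show ?thesis using re by (simp add: complex_eq_iff)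
qed

text \<open>Jensen's inequality for \<open>s \<mapsto> 1 / s\<close>: the two weights are reciprocal because
  \<open>(1 - c b\<^sub>t(y)) (1 + c b\<^sub>t(x)) = 1 - c\<^sup>2\<close>.\<close>

lemma RS_real_inequality:
  fixes \<Omega> :: "complex \<Rightarrow> 'a::complex_hilbert_space \<Rightarrow>\<^sub>L 'a"
  assumes \<Omega>: "\<Omega> \<in> RS" and x: "\<bar>x\<bar> < 1" and y: "\<bar>y\<bar> < 1"
  defines "c \<equiv> (y - x) / (1 - x * y)"
  shows "0 \<le> Re (cinner (u + c *\<^sub>R \<Omega> (of_real x) u) u / of_real (1 - c\<^sup>2)
    - 2 * cinner u v + cinner (v - c *\<^sub>R \<Omega> (of_real y) v) v)"
proof -
  define ts :: "'a pencil" where "ts = [(of_real (1 / (1 - c\<^sup>2)), of_real (c / (1 - c\<^sup>2)), of_real x, u, u),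
    (-2, 0, 0, u, v), (1, - of_real c, of_real y, v, v)]"
  have xy: "0 < 1 - x * y"
    using abs_mult_less_one[of x y] x y by auto
  have "1 - c\<^sup>2 = (1 - x\<^sup>2) * (1 - y\<^sup>2) / (1 - x * y)\<^sup>2"
    using xy unfolding c_def by (simp add: power_divide divide_simps) (simp add: power2_eq_square algebra_simps)
  then have c: "0 < 1 - c\<^sup>2"
    using x y xy by (simp add: abs_square_less_1)
  have "0 \<le> Re (pencil_form \<kappa> t ts)" if \<kappa>: "pos_form \<kappa>" and t: "\<bar>t\<bar> \<le> 1" for \<kappa> t
  proof -
    have tx: "0 < 1 - t * x" and ty: "0 < 1 - t * y"
      using abs_mult_less_one[OF x t] abs_mult_less_one[OF y t] by (auto simp: mult.commute)
    define bx where "bx = (x - t) / (1 - t * x)"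
    define b where "b = (y - t) / (1 - t * y)"
    have mob: "mob t (of_real x) = of_real bx" "mob t (of_real y) = of_real b"
      by (simp_all add: mob_def bx_def b_def)
    have prod: "(1 - c * b) * (1 + c * bx) = 1 - c\<^sup>2"
      using tx ty xy unfolding c_def bx_def b_def
      by (simp add: divide_simps) (simp add: power2_eq_square algebra_simps)
    have "1 + c * bx = ((1 - x\<^sup>2) * (1 - t * y)) / ((1 - x * y) * (1 - t * x))"
      using tx xy unfolding c_def bx_def by (simp add: divide_simps) (simp add: power2_eq_square algebra_simps)
    then have pos: "0 < 1 + c * bx" using tx ty xy x by (simp add: abs_square_less_1)
    then have p: "0 < 1 - c * b" using prod c by (metis zero_less_mult_pos2)
    have "inverse (1 - c * b) = (1 + c * bx) / (1 - c\<^sup>2)"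
      using prod p pos c by (simp add: field_simps)
    then have "1 / (1 - c\<^sup>2) + c / (1 - c\<^sup>2) * bx = inverse (1 - c * b)"
      by (simp add: add_divide_distrib)
    then have "of_real (1 / (1 - c\<^sup>2)) + of_real (c / (1 - c\<^sup>2)) * of_real bx = complex_of_real (inverse (1 - c * b))"
      by (metis of_real_add of_real_mult)
    then have "pencil_form \<kappa> t ts = of_real (inverse (1 - c * b)) * \<kappa> u u - 2 * \<kappa> u v + of_real (1 - c * b) * \<kappa> v v"
      by (simp add: ts_def mob)
    then show ?thesis using pos_form_weighted_square[OF \<kappa> p] by simp
  qed
  moreover have "\<forall>(c, d, z, x, y)\<in>set ts. z \<in> slit_plane"
    using x y zero_in_slit_plane by (simp add: ts_def of_real_in_slit_plane)
  ultimately have "0 \<le> Re (pencil_value \<Omega> ts)"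
    by (intro RS_pencil_nonneg[OF \<Omega>]) (simp add: pencil_nonneg_def)
  also have "pencil_value \<Omega> ts = cinner (u + c *\<^sub>R \<Omega> (of_real x) u) u / of_real (1 - c\<^sup>2)
    - 2 * cinner u v + cinner (v - c *\<^sub>R \<Omega> (of_real y) v) v"
    by (simp add: ts_def cinner_simps add_divide_distrib)
  finally show ?thesis .
qed

section \<open>Comparison of \<Omega> with the Moebius form\<close>

text \<open>Expresses \<open>\<Omega>(z) = (z + A) (1 + z A)\<^sup>-\<^sup>1\<close> with \<open>A = \<Omega>(0)\<close>, free of inverses.\<close>

definition is_mobius_at :: "(complex \<Rightarrow> 'a::complex_hilbert_space \<Rightarrow>\<^sub>L 'a) \<Rightarrow> complex \<Rightarrow> bool" where
  "is_mobius_at \<Omega> z \<longleftrightarrow> (\<forall>g. \<Omega> z (g + z *\<^sub>C \<Omega> 0 g) = z *\<^sub>C g + \<Omega> 0 g)"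

text \<open>Jensen's inequality bounds \<open>(I - c \<Omega>(y))\<^sup>-\<^sup>1\<close> by
  \<open>(I + c \<Omega>(x)) / (1 - c\<^sup>2)\<close>. The left side is explicit when \<Omega>(y)
  has the Moebius form, and \<open>c\<close> has the sign of \<open>y - x\<close>, which decides the
  direction of the comparison.\<close>

lemma RS_compare:
  assumes \<Omega>: "\<Omega> \<in> RS" and x: "\<bar>x\<bar> < 1" and y: "\<bar>y\<bar> < 1" and ag: "is_mobius_at \<Omega> (of_real y)"
  defines "A \<equiv> blinfun_apply (\<Omega> 0)"
  shows "0 \<le> (y - x) * Re (cinner (\<Omega> (of_real x) (g + x *\<^sub>R A g) - (x *\<^sub>R g + A g)) (g + x *\<^sub>R A g))"
proof -
  define c where "c = (y - x) / (1 - x * y)"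
  define u where "u = g + x *\<^sub>R A g"
  \<comment> \<open>Chosen so that \<open>v = k (g + y A g)\<close> solves
    \<open>v - c \<Omega>(y) v = u\<close>, which makes the quadratic inequality sharp in
    \<open>v\<close>.\<close>
  define k where "k = (1 - x * y) / (1 - y\<^sup>2)"
  define v where "v = k *\<^sub>R (g + y *\<^sub>R A g)"
  have x2: "0 < 1 - x\<^sup>2" and y2: "0 < 1 - y\<^sup>2" using x y by (simp_all add: abs_square_less_1)
  have xy: "0 < 1 - x * y"
    using abs_mult_less_one[of x y] x y by auto
  have "\<Omega> (of_real y) (g + y *\<^sub>R A g) = y *\<^sub>R g + A g"
    using ag unfolding is_mobius_at_def A_def by (simp add: scaleC_of_real)
  then have vy: "\<Omega> (of_real y) v = k *\<^sub>R (y *\<^sub>R g + A g)"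
    by (simp only: v_def blinfun.scaleR_right)
  have "v - c *\<^sub>R \<Omega> (of_real y) v = (k * (1 - c * y)) *\<^sub>R g + (k * (y - c)) *\<^sub>R A g"
    unfolding vy by (simp add: v_def algebra_simps)
  also have "k * (1 - c * y) = 1"
    using xy y2 by (simp add: k_def c_def divide_simps) (simp add: power2_eq_square algebra_simps)
  also have "k * (y - c) = x"
    using xy y2 by (simp add: k_def c_def divide_simps) (simp add: power2_eq_square algebra_simps)
  finally have v: "v - c *\<^sub>R \<Omega> (of_real y) v = u" by (simp add: u_def)
  have c2: "1 - c\<^sup>2 = (1 - x\<^sup>2) * (1 - y\<^sup>2) / (1 - x * y)\<^sup>2"
    using xy unfolding c_def by (simp add: power_divide divide_simps) (simp add: power2_eq_square algebra_simps)
  have "0 \<le> Re (cinner (u + c *\<^sub>R \<Omega> (of_real x) u) u / of_real (1 - c\<^sup>2)) - inner u v"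
    using RS_real_inequality[OF \<Omega> x y, of u v, folded c_def] unfolding v
    by (simp add: Re_cinner inner_commute)
  then have "0 \<le> (inner u u + c * inner (\<Omega> (of_real x) u) u) / (1 - c\<^sup>2) - inner v u"
    by (simp add: Re_cinner inner_add_left inner_commute[of v])
  moreover define P where "P = inner g u"
  moreover define Q where "Q = inner (A g) u"
  moreover define W where "W = inner (\<Omega> (of_real x) u) u"
  ultimately have "0 \<le> (P + x * Q + c * W) / (1 - c\<^sup>2) - k * (P + y * Q)"
    by (simp add: v_def inner_add_left) (simp add: u_def inner_add_left)
  also have "\<dots> = (y - x) * (W - (x * P + Q)) * ((1 - x * y) / ((1 - x\<^sup>2) * (1 - y\<^sup>2)))"
  proof -
    have gen: "(P + x * Q + d / D * W) / (X * Y / D\<^sup>2) - D / Y * (P + y * Q)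
        = (D * (P + x * Q) + d * W - X * (P + y * Q)) * (D / (X * Y))"
      if "X \<noteq> 0" "Y \<noteq> 0" "D \<noteq> 0" for d X Y D :: real
      using that by (simp add: field_simps power2_eq_square)
    have "(1 - x * y) * (P + x * Q) + (y - x) * W - (1 - x\<^sup>2) * (P + y * Q) = (y - x) * (W - (x * P + Q))"
      by (simp add: power2_eq_square algebra_simps)
    with gen[of "1 - x\<^sup>2" "1 - y\<^sup>2" "1 - x * y" "y - x"] x2 y2 xy show ?thesis
      unfolding c2 unfolding k_def c_def by simp
  qed
  finally have "0 \<le> (y - x) * (W - (x * P + Q)) * ((1 - x * y) / ((1 - x\<^sup>2) * (1 - y\<^sup>2)))" .
  moreover have "0 < (1 - x * y) / ((1 - x\<^sup>2) * (1 - y\<^sup>2))" using x2 y2 xy by simp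
  ultimately have "0 \<le> (y - x) * (W - (x * P + Q))"
    using zero_le_mult_iff not_less by blast
  then show ?thesis
    by (simp add: Re_cinner inner_diff_left inner_add_left P_def Q_def W_def flip: u_def)
qed


text \<open>The defect \<open>B\<close> satisfies inequalities of opposite sign from the two sides,
  so the quadratic form of \<open>B\<close> against \<open>C = I + x A\<close> vanishes. Since that
  form is hermitian, polarization gives \<open>C B = 0\<close>, and \<open>C\<close> is
  injective.\<close>

lemma RS_is_mobius_at_real:
  assumes \<Omega>: "\<Omega> \<in> RS" and x: "\<bar>x\<bar> < 1"
    and y: "\<bar>y\<bar> < 1" "x < y" "is_mobius_at \<Omega> (of_real y)"
    and z: "\<bar>z\<bar> < 1" "z < x" "is_mobius_at \<Omega> (of_real z)"
  shows "is_mobius_at \<Omega> (of_real x)"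
proof -
  define A where "A = blinfun_apply (\<Omega> 0)"
  define X where "X = blinfun_apply (\<Omega> (of_real x))"
  define C where "C g = g + x *\<^sub>R A g" for g
  define B where "B g = X (C g) - (x *\<^sub>R g + A g)" for g
  have sx: "of_real x \<in> slit_plane" by (rule of_real_in_slit_plane[OF x])
  have A_sym: "cinner (A g) h = cinner g (A h)" for g h
    using RS_adjoint[OF \<Omega> zero_in_slit_plane] by (simp add: A_def)
  have X_sym: "cinner (X g) h = cinner g (X h)" for g h
    using RS_adjoint[OF \<Omega> sx] by (simp add: X_def)
  have C_sym: "cinner (C g) h = cinner g (C h)" for g h
    by (simp add: C_def cinner_simps A_sym)
  have A_add: "A (g + h) = A g + A h" and A_scale: "A (c *\<^sub>C g) = c *\<^sub>C A g" for g h c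
    using RS_complex_linear[OF \<Omega> zero_in_slit_plane] by (simp_all add: A_def blinfun.add_right)
  have X_add: "X (g + h) = X g + X h" and X_scale: "X (c *\<^sub>C g) = c *\<^sub>C X g" for g h c
    using RS_complex_linear[OF \<Omega> sx] by (simp_all add: X_def blinfun.add_right)
  have C_add: "C (g + h) = C g + C h" and C_scale: "C (c *\<^sub>C g) = c *\<^sub>C C g" for g h c
    by (simp_all add: C_def A_add A_scale scaleR_add_right scaleC_add_right scaleC_scaleC mult.commute
        flip: scaleC_of_real)
  have B_add: "B (g + h) = B g + B h" for g h
    by (simp add: B_def C_add X_add A_add scaleR_add_right)
  have B_scale: "cinner (B (c *\<^sub>C g)) h = c * cinner (B g) h" for g h c
    by (simp add: B_def C_scale X_scale A_scale cinner_simps algebra_simps)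
  have "cinner (B g) (C h) = cinner (C g) (B h)" for g h
    by (simp add: B_def cinner_diff_left cinner_diff_right X_sym)
       (simp add: C_def cinner_simps A_sym algebra_simps)
  then have herm: "cinner (B g) (C h) = cnj (cinner (B h) (C g))" for g h
    by (metis cinner_commute)
  have zero: "Re (cinner (B g) (C g)) = 0" for g
  proof -
    have "0 \<le> (y - x) * Re (cinner (B g) (C g))" "0 \<le> (z - x) * Re (cinner (B g) (C g))"
      using RS_compare[OF \<Omega> x y(1,3), of g] RS_compare[OF \<Omega> x z(1,3), of g]
      by (simp_all add: B_def C_def X_def A_def)
    then show ?thesis using y(2) z(2) by (simp add: zero_le_mult_iff)
  qed
  have "pos_form (\<lambda>g h. cinner (B g) (C h))"
    unfolding pos_form_def
    by (intro conjI allI herm) (simp_all add: B_add B_scale zero cinner_add_left)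
  from pos_form_zero[OF this zero] have CB: "C (B g) = 0" for g
    by (rule_tac cinner_eq_zeroI) (simp add: C_sym)
  \<comment> \<open>Injectivity of \<open>C\<close>: from \<open>x A b = - b\<close> and the bounds
    on \<open>A = \<Omega> 0\<close> one gets that the squared norm of \<open>b\<close> is at most
    \<bar>x\<bar> times itself, with \<open>\<bar>x\<bar> < 1\<close>.\<close>
  have "B g = 0" for g
  proof -
    define b where "b = B g"
    have "x *\<^sub>R A b = - b" using CB[of g] by (simp add: C_def b_def eq_neg_iff_add_eq_0 add.commute)
    then have "x * inner (A b) b = - inner b b"
      by (metis inner_minus_left inner_scaleR_left)
    moreover have "\<bar>inner (A b) b\<bar> \<le> inner b b"
      using RS_real_bounds[OF \<Omega>, of 0 b] by (simp add: A_def Re_cinner)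
    then have "\<bar>x * inner (A b) b\<bar> \<le> \<bar>x\<bar> * inner b b"
      unfolding abs_mult by (intro mult_left_mono) auto
    ultimately have "(1 - \<bar>x\<bar>) * inner b b \<le> 0" by (simp add: algebra_simps)
    then have "inner b b \<le> 0" using x by (simp add: mult_le_0_iff)
    then have "inner b b = 0" using inner_ge_zero[of b] by (rule order_antisym)
    then show ?thesis by (simp add: b_def)
  qed
  then show ?thesis
    by (simp add: is_mobius_at_def B_def C_def X_def A_def scaleC_of_real)
qed

lemma RS_is_mobius_at_everywhere:
  assumes \<Omega>: "\<Omega> \<in> RS" and ag: "\<And>x. \<bar>x\<bar> < 1 \<Longrightarrow> is_mobius_at \<Omega> (of_real x)" and z: "z \<in> slit_plane"
  shows "is_mobius_at \<Omega> z"
  unfolding is_mobius_at_def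
proof (rule allI, rule cinner_ext)
  fix g h
  let ?U = "complex_of_real ` {-1<..<1}"
  \<comment> \<open>Linearity separates \<open>z\<close> from the vectors, leaving matrix elements
    of \<open>\<Omega> z\<close> between fixed vectors, to which the identity theorem applies on
    \<open>(-1, 1)\<close>.\<close>
  have split: "cinner (\<Omega> z (g + z *\<^sub>C \<Omega> 0 g)) h = cinner (\<Omega> z g) h + z * cinner (\<Omega> z (\<Omega> 0 g)) h"
    if "z \<in> slit_plane" for z
    by (simp add: blinfun.add_right RS_complex_linear[OF \<Omega> that] cinner_simps)
  have "cinner (\<Omega> z g) h + z * cinner (\<Omega> z (\<Omega> 0 g)) h = z * cinner g h + cinner (\<Omega> 0 g) h"
    using z
  proof (rule RS_holomorphic_eq[where U = ?U and \<xi> = 0, rotated -1])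
    show "(\<lambda>z. cinner (\<Omega> z g) h + z * cinner (\<Omega> z (\<Omega> 0 g)) h) holomorphic_on slit_plane"
      by (intro holomorphic_intros RS_cinner_holomorphic[OF \<Omega>])
    show sub: "?U \<subseteq> slit_plane" by (auto simp: of_real_in_slit_plane abs_less_iff)
    show "0 islimpt ?U"
      unfolding islimpt_approachable
    proof (intro allI impI)
      fix e :: real assume "0 < e"
      then show "\<exists>w\<in>?U. w \<noteq> 0 \<and> dist w 0 < e"
        by (intro bexI[of _ "of_real (min (e / 2) (1 / 2))"]) auto
    qed
    fix w assume w: "w \<in> ?U"
    then have "is_mobius_at \<Omega> w" using ag by (auto simp: abs_less_iff)
    then have "cinner (\<Omega> w (g + w *\<^sub>C \<Omega> 0 g)) h = cinner (w *\<^sub>C g + \<Omega> 0 g) h"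
      by (simp add: is_mobius_at_def)
    then show "cinner (\<Omega> w g) h + w * cinner (\<Omega> w (\<Omega> 0 g)) h = w * cinner g h + cinner (\<Omega> 0 g) h"
      using w sub by (subst (asm) split) (auto simp: cinner_simps)
  qed (auto intro!: holomorphic_intros zero_in_slit_plane)
  then show "cinner (\<Omega> z (g + z *\<^sub>C \<Omega> 0 g)) h = cinner (z *\<^sub>C g + \<Omega> 0 g) h"
    by (simp add: split[OF z] cinner_simps)
qed

text \<open>Since \<open>cnj z = 1 / z\<close>, the Moebius form at \<open>z\<close> and at
  \<open>cnj z\<close> shows that \<open>\<Omega> (cnj z) \<Omega> z\<close> fixes the range of
  \<open>I + z A\<close>. The selfadjoint defect \<open>Y\<close> therefore has its values in the
  kernel of \<open>I + cnj z A\<close>, which is trivial because \<open>A\<close> is selfadjoint and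
  \<open>z\<close> is not real.\<close>

lemma RS_is_mobius_at_isometric:
  assumes \<Omega>: "\<Omega> \<in> RS" and ag: "\<And>z. z \<in> slit_plane \<Longrightarrow> is_mobius_at \<Omega> z"
    and z: "cmod z = 1" "Im z \<noteq> 0"
  shows "op_isometric (\<Omega> z)"
proof -
  have sz: "z \<in> slit_plane" and scz: "cnj z \<in> slit_plane" using z by (simp_all add: slit_plane_iff)
  have zz: "z * cnj z = 1" using complex_norm_square[of z] z by simp
  define A where "A = blinfun_apply (\<Omega> 0)"
  define Y where "Y u = \<Omega> (cnj z) (\<Omega> z u) - u" for u
  have adj: "cinner (\<Omega> (cnj z) (\<Omega> z u)) v = cinner (\<Omega> z u) (\<Omega> z v)" for u v
    using RS_adjoint[OF \<Omega> scz] by simp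
  have adj': "cinner u (\<Omega> (cnj z) (\<Omega> z v)) = cinner (\<Omega> z u) (\<Omega> z v)" for u v
    using RS_adjoint[OF \<Omega> sz] by simp
  have A_sym: "cinner (A g) h = cinner g (A h)" for g h
    using RS_adjoint[OF \<Omega> zero_in_slit_plane] by (simp add: A_def)
  have Y_zero: "Y (g + z *\<^sub>C A g) = 0" for g
  proof -
    have "\<Omega> z (g + z *\<^sub>C A g) = z *\<^sub>C g + A g"
      using ag[OF sz] by (simp add: is_mobius_at_def A_def)
    also have "\<dots> = z *\<^sub>C (g + cnj z *\<^sub>C A g)"
      by (simp add: scaleC_add_right scaleC_scaleC zz)
    finally have "\<Omega> (cnj z) (\<Omega> z (g + z *\<^sub>C A g)) = z *\<^sub>C \<Omega> (cnj z) (g + cnj z *\<^sub>C A g)"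
      by (simp add: RS_complex_linear[OF \<Omega> scz])
    also have "\<Omega> (cnj z) (g + cnj z *\<^sub>C A g) = cnj z *\<^sub>C g + A g"
      using ag[OF scz] by (simp add: is_mobius_at_def A_def)
    also have "z *\<^sub>C \<dots> = g + z *\<^sub>C A g"
      by (simp add: scaleC_add_right scaleC_scaleC zz)
    finally show ?thesis by (simp add: Y_def)
  qed
  have "Y v = 0" for v
  proof -
    define h where "h = Y v"
    have "h + cnj z *\<^sub>C A h = 0"
    proof (rule cinner_eq_zeroI)
      fix g
      have "cinner (g + z *\<^sub>C A g) h = cinner (Y (g + z *\<^sub>C A g)) v"
        by (simp add: h_def Y_def cinner_diff_left cinner_diff_right adj adj')
      then have "cinner g h + z * cinner g (A h) = 0"
        unfolding Y_zero by (simp add: cinner_simps A_sym)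
      then have "cnj (cinner g h + z * cinner g (A h)) = 0" by simp
      then show "cinner (h + cnj z *\<^sub>C A h) g = 0"
        by (simp add: cinner_simps flip: cinner_commute)
    qed
    \<comment> \<open>As \<open>cinner (A h) h\<close> is real and \<open>Im z\<close> is nonzero,
      the imaginary part forces this product to vanish, and then the real part gives
      \<open>h = 0\<close>.\<close>
    then have "cinner (h + cnj z *\<^sub>C A h) h = 0" by simp
    then have eq: "of_real ((norm h)\<^sup>2) + cnj z * cinner (A h) h = 0"
      by (simp only: cinner_simps cinner_self)
    have "cinner (A h) h = cnj (cinner (A h) h)"
      by (metis A_sym cinner_commute)
    then have "Im (cinner (A h) h) = 0" by (simp add: complex_eq_iff)
    moreover from this arg_cong[OF eq, of Im] have "Re (cinner (A h) h) = 0" using z(2) by simp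
    ultimately show ?thesis using arg_cong[OF eq, of Re] by (simp add: h_def)
  qed
  then have "\<Omega> (cnj z) (\<Omega> z u) = u" for u by (simp add: Y_def)
  then have "cinner (\<Omega> z u) (\<Omega> z u) = cinner u u" for u using adj[of u u] by simp
  then have "(norm (\<Omega> z u))\<^sup>2 = (norm u)\<^sup>2" for u
    unfolding cinner_self of_real_eq_iff .
  then show ?thesis by (simp add: op_isometric_def)
qed

lemma AE_circle_nonreal: "AE t in lebesgue_on {0..2 * pi}. Im (cis t) \<noteq> 0"
proof -
  have "negligible {0, pi, 2 * pi}" by (rule negligible_finite) simp
  then have "{0, pi, 2 * pi} \<in> null_sets lebesgue" by (simp add: negligible_iff_null_sets)
  then have "AE t in lebesgue. t \<notin> {0, pi, 2 * pi}" by (rule AE_not_in)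
  then have "AE t in lebesgue. t \<in> {0..2 * pi} \<longrightarrow> Im (cis t) \<noteq> 0"
  proof (rule eventually_mono)
    fix t assume "t \<notin> {0, pi, 2 * pi}"
    then show "t \<in> {0..2 * pi} \<longrightarrow> Im (cis t) \<noteq> 0"
      using sin_gt_zero[of t] sin_lt_zero[of t] by force
  qed
  then show ?thesis by (subst AE_restrict_space_iff) auto
qed

section \<open>Iteration of the functional equation on the real interval\<close>

text \<open>The functional equation on \<open>(-1, 1)\<close> with the inverse multiplied out. The
  polynomial relation between \<open>x\<close> and \<open>y\<close> keeps its shape when
  \<open>x\<close> and \<open>y\<close> are exchanged and \<open>a\<close> changes sign.\<close>

definition mobius_related :: "(complex \<Rightarrow> 'a::complex_hilbert_space \<Rightarrow>\<^sub>L 'a) \<Rightarrow> real \<Rightarrow> bool" where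
  "mobius_related \<Omega> a \<longleftrightarrow> (\<forall>x y u. \<bar>x\<bar> < 1 \<longrightarrow> \<bar>y\<bar> < 1 \<longrightarrow> y * (1 + a * x) = x + a \<longrightarrow>
    \<Omega> (of_real x) (u - a *\<^sub>R \<Omega> (of_real y) u) = \<Omega> (of_real y) u - a *\<^sub>R u)"

text \<open>Adjoints of the relation with \<open>x\<close> and \<open>y\<close> exchanged: \<Omega>
  is selfadjoint at real points, and a rearrangement gives the relation for
  \<open>- a\<close>.\<close>

lemma mobius_related_minus:
  assumes \<Omega>: "\<Omega> \<in> RS" and rel: "mobius_related \<Omega> a"
  shows "mobius_related \<Omega> (- a)"
  unfolding mobius_related_def
proof (intro allI impI, rule cinner_ext)
  fix x y u v assume xy: "\<bar>x\<bar> < 1" "\<bar>y\<bar> < 1" "y * (1 + - a * x) = x + - a"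
  have sym: "cinner (\<Omega> (of_real s) u) v = cinner u (\<Omega> (of_real s) v)" if "\<bar>s\<bar> < 1" for s u v
    using RS_adjoint[OF \<Omega> of_real_in_slit_plane[OF that]] by simp
  have "x * (1 + a * y) = y + a" using xy(3) by (simp add: algebra_simps)
  then have "\<Omega> (of_real y) (v - a *\<^sub>R \<Omega> (of_real x) v) = \<Omega> (of_real x) v - a *\<^sub>R v"
    using rel xy by (simp add: mobius_related_def)
  then have "cinner u (\<Omega> (of_real y) (v - a *\<^sub>R \<Omega> (of_real x) v)) = cinner u (\<Omega> (of_real x) v - a *\<^sub>R v)"
    by simp
  then show "cinner (\<Omega> (of_real x) (u - - a *\<^sub>R \<Omega> (of_real y) u)) v = cinner (\<Omega> (of_real y) u - - a *\<^sub>R u) v"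
    by (simp add: blinfun.add_right blinfun.diff_right blinfun.scaleR_right cinner_simps sym xy algebra_simps)
qed

text \<open>For \<open>u = g + y A g\<close> both sides of the relation are \<open>1 - a * y\<close>
  times the corresponding sides of the Moebius form at \<open>x\<close>, so the form passes from
  \<open>y\<close> to \<open>x = (y - a) / (1 - a y)\<close>.\<close>

lemma mobius_related_is_mobius_at:
  assumes rel: "mobius_related \<Omega> a" and "\<bar>a\<bar> < 1" "\<bar>x\<bar> < 1" "\<bar>y\<bar> < 1" "y * (1 + a * x) = x + a"
    and ag: "is_mobius_at \<Omega> (of_real y)"
  shows "is_mobius_at \<Omega> (of_real x)"
  unfolding is_mobius_at_def
proof
  fix g
  define A where "A = blinfun_apply (\<Omega> 0)"
  define u where "u = g + y *\<^sub>R A g"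
  have ay: "1 - a * y \<noteq> 0" using abs_mult_less_one[of a y] assms by auto
  have x: "x * (1 - a * y) = y - a" using assms(5) by (simp add: algebra_simps)
  have yu: "\<Omega> (of_real y) u = y *\<^sub>R g + A g"
    using ag by (simp add: is_mobius_at_def A_def u_def scaleC_of_real)
  have "\<Omega> (of_real x) (u - a *\<^sub>R \<Omega> (of_real y) u) = \<Omega> (of_real y) u - a *\<^sub>R u"
    using rel assms by (simp add: mobius_related_def)
  moreover have "u - a *\<^sub>R \<Omega> (of_real y) u = (1 - a * y) *\<^sub>R g + (y - a) *\<^sub>R A g"
    unfolding yu by (simp add: u_def algebra_simps)
  then have "u - a *\<^sub>R \<Omega> (of_real y) u = (1 - a * y) *\<^sub>R (g + x *\<^sub>R A g)"
    unfolding x[symmetric] by (simp add: scaleR_add_right mult.commute)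
  moreover have "\<Omega> (of_real y) u - a *\<^sub>R u = (y - a) *\<^sub>R g + (1 - a * y) *\<^sub>R A g"
    unfolding yu by (simp add: u_def algebra_simps)
  then have "\<Omega> (of_real y) u - a *\<^sub>R u = (1 - a * y) *\<^sub>R (x *\<^sub>R g + A g)"
    unfolding x[symmetric] by (simp add: scaleR_add_right mult.commute)
  ultimately have "\<Omega> (of_real x) (g + x *\<^sub>R A g) = x *\<^sub>R g + A g"
    using ay by (simp add: blinfun.scaleR_right)
  then show "\<Omega> (of_real x) (g + of_real x *\<^sub>C \<Omega> 0 g) = of_real x *\<^sub>C g + \<Omega> 0 g"
    by (simp add: A_def scaleC_of_real)
qed

text \<open>The orbit of 0, where the Moebius form is trivial, under
  \<open>y \<mapsto> (y + a) / (1 + a y)\<close>; each step shrinks the distance to 1 by a factor of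
  at most \<open>1 - a\<close>. The sign \<open>s\<close> directs the orbit to 1 or -1, and the
  parameter is \<open>- (s * a)\<close> because the form travels against the Moebius shift.\<close>

lemma mobius_related_orbit:
  assumes a: "0 < a" "a < 1" and s: "s * s = 1" and rel: "mobius_related \<Omega> (- (s * a))"
  shows "\<exists>y. 0 \<le> y \<and> y < 1 \<and> 1 - y \<le> (1 - a) ^ n \<and> is_mobius_at \<Omega> (of_real (s * y))"
proof (induction n)
  case 0
  have "0 *\<^sub>C x = 0" for x :: 'a using scaleC_of_real[of 0 x] by simp
  then show ?case by (intro exI[of _ 0]) (simp add: is_mobius_at_def)
next
  case (Suc n)
  then obtain y where y: "0 \<le> y" "y < 1" "1 - y \<le> (1 - a) ^ n" "is_mobius_at \<Omega> (of_real (s * y))" by blast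
  have ay: "1 \<le> 1 + a * y" using a y by simp
  then have ay0: "0 < 1 + a * y" by linarith
  define y' where "y' = (y + a) / (1 + a * y)"
  have "1 - y' = (1 - a) * (1 - y) / (1 + a * y)"
    using ay0 by (simp add: y'_def divide_simps) (simp add: algebra_simps)
  moreover have "(1 - a) * (1 - y) / (1 + a * y) \<le> (1 - a) * (1 - y)"
    using ay ay0 a y divide_left_mono[of 1 "1 + a * y" "(1 - a) * (1 - y)"] by simp
  moreover have "(1 - a) * (1 - y) \<le> (1 - a) * (1 - a) ^ n"
    using a y by (intro mult_left_mono) auto
  moreover have "0 < (1 - a) * (1 - y) / (1 + a * y)"
    using a y ay0 by (intro divide_pos_pos mult_pos_pos) auto
  ultimately have "1 - y' \<le> (1 - a) ^ Suc n" "y' < 1" by auto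
  moreover have y'0: "0 \<le> y'" using a y by (simp add: y'_def)
  moreover have "\<bar>s\<bar> = 1" using s by (auto simp: square_eq_1_iff)
  then have abs_s: "\<bar>s * r\<bar> = \<bar>r\<bar>" for r by (simp add: abs_mult)
  have "is_mobius_at \<Omega> (of_real (s * y'))"
  proof (rule mobius_related_is_mobius_at[OF rel _ _ _ _ y(4)])
    have "y' * (1 + a * y) = y + a" using ay0 by (simp add: y'_def)
    then have e: "y * (1 - a * y') = y' - a" by (simp add: algebra_simps)
    have "s * y * (1 + - (s * a) * (s * y')) = s * (y * (1 - (s * s) * (a * y')))"
      by (simp add: algebra_simps)
    also have "\<dots> = s * (y' - a)" unfolding s by (simp add: e)
    finally show "s * y * (1 + - (s * a) * (s * y')) = s * y' + - (s * a)"
      by (simp add: algebra_simps)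
  qed (use a y \<open>y' < 1\<close> y'0 abs_s in auto)
  ultimately show ?case by blast
qed

lemma mobius_related_is_mobius:
  assumes \<Omega>: "\<Omega> \<in> RS" and a: "\<bar>a\<bar> < 1" "a \<noteq> 0" and rel: "mobius_related \<Omega> a"
    and x: "\<bar>x\<bar> < 1"
  shows "is_mobius_at \<Omega> (of_real x)"
proof -
  define b where "b = \<bar>a\<bar>"
  have b: "0 < b" "b < 1" using a by (auto simp: b_def)
  have rel': "mobius_related \<Omega> b" "mobius_related \<Omega> (- b)"
    using rel mobius_related_minus[OF \<Omega> rel] by (auto simp: b_def abs_if)
  \<comment> \<open>After \<open>n\<close> steps the orbits towards 1 and -1 have both passed
    \<bar>x\<bar> in modulus, so they enclose \<open>x\<close>.\<close>
  obtain n where n: "(1 - b) ^ n < 1 - \<bar>x\<bar>"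
    using real_arch_pow_inv[of "1 - \<bar>x\<bar>" "1 - b"] x b by auto
  obtain y where "0 \<le> y" "y < 1" "1 - y \<le> (1 - b) ^ n" "is_mobius_at \<Omega> (of_real (1 * y))"
    using mobius_related_orbit[OF b, of 1 \<Omega> n] rel' by auto
  moreover obtain z where "0 \<le> z" "z < 1" "1 - z \<le> (1 - b) ^ n" "is_mobius_at \<Omega> (of_real (-1 * z))"
    using mobius_related_orbit[OF b, of "-1" \<Omega> n] rel' by auto
  ultimately show ?thesis
    using n by (intro RS_is_mobius_at_real[OF \<Omega> x, of "1 * y" "-1 * z"]) (auto simp: abs_less_iff)
qed

lemma functional_equation_imp_related:
  assumes a: "\<bar>a\<bar> < 1" and eq: "\<And>z. z \<in> slit_plane \<Longrightarrow>
          op_invertible (id_blinfun - a *\<^sub>R \<Omega> ((z + of_real a) / (1 + of_real a * z))) \<and>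
          \<Omega> z = (\<Omega> ((z + of_real a) / (1 + of_real a * z)) - a *\<^sub>R id_blinfun) o\<^sub>L
                 op_inverse (id_blinfun - a *\<^sub>R \<Omega> ((z + of_real a) / (1 + of_real a * z)))"
  shows "mobius_related \<Omega> a"
  unfolding mobius_related_def
proof (intro allI impI)
  fix x y u assume xy: "\<bar>x\<bar> < 1" "\<bar>y\<bar> < 1" "y * (1 + a * x) = x + a"
  have "1 + a * x \<noteq> 0" using abs_mult_less_one[of a x] a xy by auto
  then have "y = (x + a) / (1 + a * x)" using xy(3) by (simp add: field_simps)
  then have y: "(of_real x + of_real a) / (1 + of_real a * of_real x) = complex_of_real y" by simp
  define T where "T = id_blinfun - a *\<^sub>R \<Omega> (of_real y)"
  have T: "op_invertible T" "\<Omega> (of_real x) = (\<Omega> (of_real y) - a *\<^sub>R id_blinfun) o\<^sub>L op_inverse T"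
    using eq[OF of_real_in_slit_plane[OF xy(1)]] unfolding y T_def by auto
  then obtain S where "S o\<^sub>L T = id_blinfun" "T o\<^sub>L S = id_blinfun" by (auto simp: op_invertible_def)
  with op_inverse_eqI[OF this] have "op_inverse T o\<^sub>L T = id_blinfun" by simp
  then have "\<Omega> (of_real x) o\<^sub>L T = \<Omega> (of_real y) - a *\<^sub>R id_blinfun"
    by (simp add: T(2) blinfun_compose_assoc blinfun_compose_id)
  then have "(\<Omega> (of_real x) o\<^sub>L T) u = (\<Omega> (of_real y) - a *\<^sub>R id_blinfun) u" by simp
  then show "\<Omega> (of_real x) (u - a *\<^sub>R \<Omega> (of_real y) u) = \<Omega> (of_real y) u - a *\<^sub>R u"
    by (simp add: T_def blinfun.diff_left blinfun.scaleR_left)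
qed

theorem theorem6p18:
  fixes \<Omega> :: "complex \<Rightarrow>
    ('a::{complex_hilbert_space, second_countable_topology}) \<Rightarrow>\<^sub>L 'a"
  assumes "\<Omega> \<in> RS"
  shows
    "(inner_RS \<Omega> \<longrightarrow>
       (\<forall>a\<in>{-1<..<1::real}. \<forall>z\<in>slit_plane.
          op_invertible (id_blinfun - a *\<^sub>R \<Omega> ((z + of_real a) / (1 + of_real a * z))) \<and>
          \<Omega> z = (\<Omega> ((z + of_real a) / (1 + of_real a * z)) - a *\<^sub>R id_blinfun) o\<^sub>L
                 op_inverse (id_blinfun - a *\<^sub>R \<Omega> ((z + of_real a) / (1 + of_real a * z)))))
     \<and>
     ((\<exists>a\<in>{-1<..<1::real}. a \<noteq> 0 \<and> (\<forall>z\<in>slit_plane.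
          op_invertible (id_blinfun - a *\<^sub>R \<Omega> ((z + of_real a) / (1 + of_real a * z))) \<and>
          \<Omega> z = (\<Omega> ((z + of_real a) / (1 + of_real a * z)) - a *\<^sub>R id_blinfun) o\<^sub>L
                 op_inverse (id_blinfun - a *\<^sub>R \<Omega> ((z + of_real a) / (1 + of_real a * z)))))
      \<longrightarrow> inner_RS \<Omega>)"
proof (intro conjI impI ballI)
  fix a z assume "inner_RS \<Omega>" "a \<in> {-1<..<1::real}" "z \<in> slit_plane"
  then show "op_invertible (id_blinfun - a *\<^sub>R \<Omega> ((z + of_real a) / (1 + of_real a * z)))"
    "\<Omega> z = (\<Omega> ((z + of_real a) / (1 + of_real a * z)) - a *\<^sub>R id_blinfun) o\<^sub>L
                 op_inverse (id_blinfun - a *\<^sub>R \<Omega> ((z + of_real a) / (1 + of_real a * z)))"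
    using inner_RS_functional_equation[of \<Omega> a z] by auto
next
  assume "\<exists>a\<in>{-1<..<1::real}. a \<noteq> 0 \<and> (\<forall>z\<in>slit_plane.
          op_invertible (id_blinfun - a *\<^sub>R \<Omega> ((z + of_real a) / (1 + of_real a * z))) \<and>
          \<Omega> z = (\<Omega> ((z + of_real a) / (1 + of_real a * z)) - a *\<^sub>R id_blinfun) o\<^sub>L
                 op_inverse (id_blinfun - a *\<^sub>R \<Omega> ((z + of_real a) / (1 + of_real a * z))))"
  then obtain a where a: "\<bar>a\<bar> < 1" "a \<noteq> 0" "mobius_related \<Omega> a"
    using functional_equation_imp_related[of _ \<Omega>] by (auto simp: abs_less_iff)
  have "is_mobius_at \<Omega> z" if "z \<in> slit_plane" for z
    by (rule RS_is_mobius_at_everywhere[OF assms mobius_related_is_mobius[OF assms a] that])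
  then have "op_isometric (\<Omega> (cis t))" if "Im (cis t) \<noteq> 0" for t
    using RS_is_mobius_at_isometric[OF assms _ _ that] by simp
  then have "AE t in lebesgue_on {0..2 * pi}. op_isometric (\<Omega> (cis t))"
    using AE_circle_nonreal by (rule eventually_mono[rotated])
  then show "inner_RS \<Omega>" using assms by (simp add: inner_RS_def)
qed

end
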